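(* Let $\{p_n\}_{n\ge1}$, $\{q_n\}_{n\ge1}$ be complex sequences with $\sum_{n\ge1}(|p_n|+|q_n|)<\infty$, let $\alpha\ne\beta$ be complex numbers with $|\alpha|=|\beta|\ne0$, and let $P_n,Q_n$ be the convergents and $f_n=P_n/Q_n$ the approximants of the continued fraction with partial numerators $-\alpha\beta+q_n$ and partial denominators $\alpha+\beta+p_n$ ($n\ge1$). Put $$a=\lim_{n\to\infty}\alpha^{-n}(P_n-\beta P_{n-1}),\quad b=-\lim_{n\to\infty}\beta^{-n}(P_n-\alpha P_{n-1}),$$ $$c=\lim_{n\to\infty}\alpha^{-n}(Q_n-\beta Q_{n-1}),\quad d=-\lim_{n\to\infty}\beta^{-n}(Q_n-\alpha Q_{n-1}),$$ and $h(z)=(az+b)/(cz+d)$. If the sequential closure of the sequence $\{f_n\}$ is a line in $\mathbb{C}$, then the point of highest concentration of approximants in the sequential closure is exactly $$x_0=\frac{h(\infty)+h(0)}{2}=\frac12\left(\frac ac+\frac bd\right).$$ Moreover, if the sequential closure is $\mathbb{R}$, then the limiting probability density function for the approximants is given by the Cauchy density function $$p(x)=\frac{\delta}{\pi[(x-x_0)^2+\delta^2]},$$ where $\delta$ is the dispersion (scale) parameter given by $$\delta=\frac{h(\infty)-h(0)}{2i}=\frac1{2i}\left(\frac ac-\frac bd\right).$$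
   Context: $\widehat{\mathbb{C}}=\mathbb{C}\cup\{\infty\}$ is the Riemann sphere. The sequential closure of a sequence in $\widehat{\mathbb{C}}$ is the set of limits of its convergent subsequences; "a line in $\mathbb{C}$" (or "$\mathbb{R}$") means the line together with $\infty$. The convergents of the continued fraction $\frac{a_1}{b_1}{\atop+}\frac{a_2}{b_2}{\atop+}\cdots=a_1/(b_1+a_2/(b_2+\cdots))$ are given by $P_{-1}=1$, $P_0=0$, $Q_{-1}=0$, $Q_0=1$, $P_n=b_nP_{n-1}+a_nP_{n-2}$, $Q_n=b_nQ_{n-1}+a_nQ_{n-2}$. At most one partial numerator is assumed to vanish, and partial numerator and denominator of equal index are not both zero. Under the stated hypotheses the four limits exist and, when the sequential closure is a line, it equals $h(\mathbb{T})$, $\mathbb{T}$ the unit circle, with $f_n$ asymptotic to $h((\alpha/\beta)^{n+1})$. Concentration: the limiting probability measure of the approximants on the sequential closure is $P(S)=\mu(h^{-1}(S))/2\pi$, $\mu$ being arc length (Lebesgue measure) on $\mathbb{T}$; the concentration at a point is the density of $P$ with respect to arc length. When the sequential closure is $\mathbb{R}$, this density $p(x)$ is called the limiting probability density function: $\int_u^v p(x)\,dx=\lim_{n\to\infty}\frac1n\#\{0\le i\le n: f_i\in[u,v]\}$ for intervals $[u,v]$ (membership being understood, when $f_i\notin\mathbb{R}$, for the asymptotically equal sequence $h((\alpha/\beta)^{i+1})$).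
   Formalization: The Cauchy density is stated with scale |δ| instead of δ, where δ = (a/c − b/d)/(2i) is shown real and nonzero; δ is negative for one labelling of α, β (e.g. p=q=0, α=e^{-i}, β=e^{i}), and then the printed p(x) is negative. *)

theory Defs
  imports "HOL-Analysis.Analysis"
begin

section \<open>The Riemann sphere\<close>

text \<open>A point of the sphere is a \<open>complex option\<close>; \<^const>\<open>None\<close> is the point at infinity.\<close>

definition riemann_sphere :: "complex option topology" where
  "riemann_sphere = Alexandroff_compactification euclidean"

definition sphere_borel :: "complex option measure" where
  "sphere_borel = sigma UNIV {U. openin riemann_sphere U}"

definition sphere_quot :: "complex \<Rightarrow> complex \<Rightarrow> complex option" where
  "sphere_quot x y = (if y = 0 then None else Some (x / y))"

fun sphere_moebius ::
  "complex \<Rightarrow> complex \<Rightarrow> complex \<Rightarrow> complex \<Rightarrow> complex option \<Rightarrow> complex option" where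
  "sphere_moebius a b c d None = sphere_quot a c"
| "sphere_moebius a b c d (Some z) = sphere_quot (a * z + b) (c * z + d)"

definition sequential_closure :: "(nat \<Rightarrow> complex option) \<Rightarrow> complex option set" where
  "sequential_closure f =
     {l. \<exists>r :: nat \<Rightarrow> nat. strict_mono r \<and> limitin riemann_sphere (f \<circ> r) l sequentially}"

definition sphere_line :: "complex \<Rightarrow> complex \<Rightarrow> complex option set" where
  "sphere_line z v = insert None (Some ` range (\<lambda>t::real. z + of_real t * v))"

definition sphere_reals :: "complex option set" where
  "sphere_reals = insert None (Some ` \<real>)"


section \<open>Convergents of a continued fraction\<close>

text \<open>
  The partial numerators are \<open>A 1, A 2, \<dots>\<close> and the partial denominators \<open>B 1, B 2, \<dots>\<close>;
  the entries at 0 are not used.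
  The index is shifted by one, so that \<open>P\<^sub>n = cf_num A B (Suc n)\<close> and
  \<open>Q\<^sub>n = cf_den A B (Suc n)\<close> also for \<open>n = -1\<close>.
\<close>

fun cf_num :: "(nat \<Rightarrow> complex) \<Rightarrow> (nat \<Rightarrow> complex) \<Rightarrow> nat \<Rightarrow> complex" where
  "cf_num A B 0 = 1"
| "cf_num A B (Suc 0) = 0"
| "cf_num A B (Suc (Suc n)) = B (Suc n) * cf_num A B (Suc n) + A (Suc n) * cf_num A B n"

fun cf_den :: "(nat \<Rightarrow> complex) \<Rightarrow> (nat \<Rightarrow> complex) \<Rightarrow> nat \<Rightarrow> complex" where
  "cf_den A B 0 = 0"
| "cf_den A B (Suc 0) = 1"
| "cf_den A B (Suc (Suc n)) = B (Suc n) * cf_den A B (Suc n) + A (Suc n) * cf_den A B n"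

definition approximant :: "(nat \<Rightarrow> complex) \<Rightarrow> (nat \<Rightarrow> complex) \<Rightarrow> nat \<Rightarrow> complex option" where
  "approximant A B n = sphere_quot (cf_num A B (Suc n)) (cf_den A B (Suc n))"


section \<open>Concentration of approximants\<close>

definition circle_arc_length :: "complex measure" where
  "circle_arc_length = distr (restrict_space lborel {0..<2 * pi}) borel cis"

definition limit_measure :: "(complex option \<Rightarrow> complex option) \<Rightarrow> complex option measure" where
  "limit_measure h =
     distr (scale_measure (ennreal (1 / (2 * pi))) circle_arc_length) sphere_borel (\<lambda>z. h (Some z))"

text \<open>This is arc length on \<open>sphere_line z v\<close> only for a unit vector \<open>v\<close>.\<close>

definition line_arc_length :: "complex \<Rightarrow> complex \<Rightarrow> complex option measure" where
  "line_arc_length z v = distr lborel sphere_borel (\<lambda>t. Some (z + of_real t * v))"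

text \<open>
  A density is determined by the measure only almost everywhere. Continuity on the line,
  the point at infinity included, selects one version and determines all its values there,
  so that the concentration at a single point is well defined.
\<close>

definition is_concentration ::
  "(complex option \<Rightarrow> complex option) \<Rightarrow> complex \<Rightarrow> complex \<Rightarrow> (complex option \<Rightarrow> real) \<Rightarrow> bool" where
  "is_concentration h z v \<rho> \<longleftrightarrow>
     \<rho> \<in> borel_measurable sphere_borel \<and>
     (\<forall>y \<in> sphere_line z v. 0 \<le> \<rho> y) \<and>
     continuous_map (subtopology riemann_sphere (sphere_line z v)) euclideanreal \<rho> \<and>
     limit_measure h = density (line_arc_length z v) (\<lambda>y. ennreal (\<rho> y))"

definition is_highest_concentration ::
  "(complex option \<Rightarrow> complex option) \<Rightarrow> complex \<Rightarrow> complex \<Rightarrow> complex option \<Rightarrow> bool" where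
  "is_highest_concentration h z v x \<longleftrightarrow>
     x \<in> sphere_line z v \<and>
     (\<exists>\<rho>. is_concentration h z v \<rho> \<and> (\<forall>y \<in> sphere_line z v. y \<noteq> x \<longrightarrow> \<rho> y < \<rho> x))"

definition has_limiting_frequencies :: "(nat \<Rightarrow> complex option) \<Rightarrow> (real \<Rightarrow> real) \<Rightarrow> bool" where
  "has_limiting_frequencies g p \<longleftrightarrow>
     (\<forall>u v. u \<le> v \<longrightarrow> p integrable_on {u..v} \<and>
        (\<lambda>n. real (card {i \<in> {0..n}. g i \<in> Some ` of_real ` {u..v}}) / real n)
          \<longlonglongrightarrow> integral {u..v} p)"

text \<open>
  \<open>f\<close> are the approximants and \<open>g\<close> is the asymptotically equal sequence on the line.
  Replacing the non-real approximants by the terms of \<open>g\<close> can be read index by index or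
  for the whole sequence; both are required.
\<close>

definition is_limiting_pdf ::
  "(nat \<Rightarrow> complex option) \<Rightarrow> (nat \<Rightarrow> complex option) \<Rightarrow> (complex option \<Rightarrow> complex option)
     \<Rightarrow> (real \<Rightarrow> real) \<Rightarrow> bool" where
  "is_limiting_pdf f g h p \<longleftrightarrow>
     is_concentration h 0 1 (\<lambda>y. case y of None \<Rightarrow> 0 | Some w \<Rightarrow> p (Re w)) \<and>
     has_limiting_frequencies (\<lambda>i. if f i \<in> sphere_reals then f i else g i) p \<and>
     has_limiting_frequencies g p"

text \<open>
  A probability density only for \<open>s > 0\<close>. Interchanging \<open>\<alpha>\<close> and \<open>\<beta>\<close> replaces \<open>h z\<close> by
  \<open>h (1 / z)\<close> and hence \<open>(h \<infinity> - h 0) / (2 * \<i>)\<close> by its negative, so the scale parameter is the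
  absolute value of that number.
\<close>

definition cauchy_density :: "real \<Rightarrow> real \<Rightarrow> real \<Rightarrow> real" where
  "cauchy_density x0 s x = s / (pi * ((x - x0)\<^sup>2 + s\<^sup>2))"

end

theory Submission
  imports Defs "HOL-Probability.Distribution_Functions"
begin

text \<open>
  Let \<open>\<zeta> = \<alpha> / \<beta>\<close>, a point of the unit circle. Numerators and denominators satisfy the same
  summable perturbation of a recurrence with characteristic roots \<open>\<alpha>\<close> and \<open>\<beta>\<close>. Variation of
  constants shows that, after division by a common factor, they are
  \<open>a \<zeta>\<^sup>n\<^sup>+\<^sup>1 + b + o(1)\<close> and \<open>c \<zeta>\<^sup>n\<^sup>+\<^sup>1 + d + o(1)\<close>. So \<open>f n\<close> behaves like \<open>h (\<zeta>\<^sup>n\<^sup>+\<^sup>1)\<close>.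

  A line is infinite. This excludes \<open>a d = b c\<close>, since then a partial numerator vanishes
  (\<open>limit_determinant_nonzero\<close>) and at most two values occur afterwards
  (\<open>two_values_after_zero\<close>), and it excludes roots of unity \<open>\<zeta>\<close>, for which the closure is
  finite. In the remaining case every limit of approximants lies in the image of the unit circle
  under \<open>h\<close> (\<open>sequential_closure_subset_image\<close>). As the line contains infinity, \<open>h\<close> has its pole on
  the circle.

  Measuring the angle from the point opposite to the pole, one finds
  \<open>h (e\<^sup>i\<^sup>\<theta>) = x0 - \<delta> tan ((\<theta> - \<theta>1) / 2)\<close> with \<open>x0\<close> and \<open>\<delta>\<close> as in the theorem
  (\<open>moebius_circle_tan\<close>). The tangent of a uniformly distributed half angle has the Cauchy
  distribution (\<open>tan_half_angle_distr\<close>). So the limiting measure has, with respect to arc length on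
  the line, the Cauchy density with centre \<open>x0\<close> and scale \<open>\<bar>\<delta>\<bar>\<close>, whose strict maximum is at \<open>x0\<close>.

  On the real line the density also has to give the frequencies. The angles of the powers of \<open>\<zeta>\<close>
  form an irrational rotation, which is equidistributed
  (\<open>irrational_rotation_equidistributed\<close>), and the tangent turns intervals of angles into real
  intervals. The approximants differ from this model sequence by amounts that tend to 0 on bounded
  sets (\<open>sphere_quot_close\<close>), and the limiting frequencies depend continuously on the end points of
  the interval, so the frequencies agree (\<open>frequencies_perturbation\<close>).
\<close>

section \<open>Almost constant three-term recurrences\<close>

lemma discrete_gronwall:
  fixes s e :: "nat \<Rightarrow> real"
  assumes e: "\<And>n. 0 \<le> e n" "summable e" and s: "\<And>n. 0 \<le> s n"
    and step: "\<And>n. s (Suc n) \<le> (1 + e n) * s n"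
  shows "s n \<le> s 0 * exp (suminf e)"
proof -
  have "s n \<le> s 0 * exp (sum e {..<n})"
  proof (induction n)
    case (Suc n)
    have "s (Suc n) \<le> (1 + e n) * s n" by (rule step)
    also have "\<dots> \<le> exp (e n) * (s 0 * exp (sum e {..<n}))"
      by (intro mult_mono Suc.IH) (use s[of n] in \<open>auto simp: exp_ge_add_one_self\<close>)
    finally show ?case by (simp add: exp_add mult_ac)
  qed simp
  also have "\<dots> \<le> s 0 * exp (suminf e)"
    using e s[of 0] by (intro mult_left_mono) (auto intro!: sum_le_suminf)
  finally show ?thesis .
qed

lemma convergent_if_summable_increments:
  fixes u :: "nat \<Rightarrow> complex"
  assumes "summable e" "\<And>n. norm (u (Suc n) - u n) \<le> e n"
  shows "convergent u"
proof -
  have "summable (\<lambda>n. u (Suc n) - u n)"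
    by (rule summable_comparison_test') (use assms in auto)
  then have "convergent (\<lambda>n. \<Sum>i<n. u (Suc i) - u i)"
    by (simp add: summable_iff_convergent)
  then have "convergent (\<lambda>n. (u n - u 0) + u 0)"
    by (intro convergent_add) (simp_all add: sum_lessThan_telescope convergent_const)
  then show ?thesis by simp
qed

text \<open>
  Multiplying the recurrence by the projections onto the two characteristic directions
  turns it into a perturbation of the trivial recurrence \<open>U (n + 1) = U n\<close>. As \<open>\<alpha>\<close> and \<open>\<beta>\<close>
  have the same modulus, neither direction dominates, and the increments of \<open>U\<close> and of \<open>W\<close> are
  both bounded by a summable multiple of \<open>norm (U n) + norm (W n)\<close>.
\<close>

locale perturbed_recurrence =
  fixes p q A B X :: "nat \<Rightarrow> complex" and \<alpha> \<beta> :: complex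
  assumes summ: "summable (\<lambda>n. norm (p (Suc n)) + norm (q (Suc n)))"
    and ne: "\<alpha> \<noteq> \<beta>" and norm_eq: "norm \<alpha> = norm \<beta>" and norm_ne: "norm \<alpha> \<noteq> 0"
    and A: "A = (\<lambda>n. - (\<alpha> * \<beta>) + q n)" and B: "B = (\<lambda>n. \<alpha> + \<beta> + p n)"
    and rec: "\<And>n. X (Suc (Suc n)) = B (Suc n) * X (Suc n) + A (Suc n) * X n"
begin

definition "U n = (X (Suc n) - \<beta> * X n) / \<alpha> ^ n"
definition "W n = (X (Suc n) - \<alpha> * X n) / \<beta> ^ n"

lemma nonzero: "\<alpha> \<noteq> 0" "\<beta> \<noteq> 0"
  using norm_eq norm_ne by auto

lemma X_eq: "(\<alpha> - \<beta>) * X n = \<alpha> ^ n * U n - \<beta> ^ n * W n"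
  and X_Suc_eq: "(\<alpha> - \<beta>) * X (Suc n) = \<alpha> ^ Suc n * U n - \<beta> ^ Suc n * W n"
  using nonzero by (auto simp: U_def W_def field_simps)

lemma U_step: "\<alpha> ^ Suc n * (U (Suc n) - U n) = p (Suc n) * X (Suc n) + q (Suc n) * X n"
  and W_step: "\<beta> ^ Suc n * (W (Suc n) - W n) = p (Suc n) * X (Suc n) + q (Suc n) * X n"
  using nonzero by (simp_all add: U_def W_def rec A B field_simps)

definition "rate n = (1 + 1 / norm \<alpha>) / norm (\<alpha> - \<beta>) * (norm (p (Suc n)) + norm (q (Suc n)))"

lemma summable_rate: "summable rate"
  unfolding rate_def by (intro summable_mult summ)

lemma rate_nonneg: "0 \<le> rate n"
  by (simp add: rate_def)

lemma perturbation_bound: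
  "norm (p (Suc n) * X (Suc n) + q (Suc n) * X n)
     \<le> norm \<alpha> ^ Suc n * (rate n * (norm (U n) + norm (W n)))"
proof -
  define r where "r = norm \<alpha>"
  have r: "r > 0" using norm_ne by (simp add: r_def)
  define S where "S = norm (U n) + norm (W n)"
  have S0: "S \<ge> 0" by (simp add: S_def)
  define D where "D = norm (\<alpha> - \<beta>)"
  have D: "D > 0" using ne by (simp add: D_def)
  have "D * norm (X n) = norm (\<alpha> ^ n * U n - \<beta> ^ n * W n)"
    by (simp add: D_def flip: norm_mult X_eq)
  also have "\<dots> \<le> r ^ n * S"
    by (rule norm_triangle_ineq4[THEN order_trans])
       (simp add: norm_mult norm_power r_def norm_eq S_def distrib_left)
  finally have 1: "norm (X n) \<le> r ^ n * S / D" using D by (simp add: field_simps)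
  have "D * norm (X (Suc n)) = norm (\<alpha> ^ Suc n * U n - \<beta> ^ Suc n * W n)"
    by (simp only: D_def flip: norm_mult X_Suc_eq)
  also have "\<dots> \<le> r ^ Suc n * S"
    by (rule norm_triangle_ineq4[THEN order_trans])
       (simp add: norm_mult norm_power r_def norm_eq S_def distrib_left)
  finally have 2: "norm (X (Suc n)) \<le> r ^ Suc n * S / D" using D by (simp add: field_simps)
  have "norm (p (Suc n) * X (Suc n) + q (Suc n) * X n)
      \<le> norm (p (Suc n)) * norm (X (Suc n)) + norm (q (Suc n)) * norm (X n)"
    by (rule norm_triangle_ineq[THEN order_trans]) (simp add: norm_mult)
  also have "\<dots> \<le> norm (p (Suc n)) * (r ^ Suc n * S / D) + norm (q (Suc n)) * (r ^ n * S / D)"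
    by (intro add_mono mult_left_mono 1 2) auto
  also have "\<dots> = (norm (p (Suc n)) + norm (q (Suc n)) / r) * (r ^ Suc n * S / D)"
    using r D by (simp add: field_simps)
  also have "\<dots> \<le> ((1 + 1 / r) * (norm (p (Suc n)) + norm (q (Suc n)))) * (r ^ Suc n * S / D)"
    using r S0 D by (intro mult_right_mono) (auto simp: field_simps)
  also have "\<dots> = r ^ Suc n * (rate n * S)"
    by (simp add: rate_def r_def D_def)
  finally show ?thesis by (simp add: r_def S_def)
qed

lemma U_increment: "norm (U (Suc n) - U n) \<le> rate n * (norm (U n) + norm (W n))"
proof -
  have "norm \<alpha> ^ Suc n * norm (U (Suc n) - U n)
      = norm (p (Suc n) * X (Suc n) + q (Suc n) * X n)"
    by (simp only: flip: U_step norm_power norm_mult)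
  then show ?thesis
    using perturbation_bound[of n] mult_le_cancel_left_pos[of "norm \<alpha> ^ Suc n"] nonzero
    by (metis zero_less_norm_iff zero_less_power)
qed

lemma W_increment: "norm (W (Suc n) - W n) \<le> rate n * (norm (U n) + norm (W n))"
proof -
  have "norm \<alpha> ^ Suc n * norm (W (Suc n) - W n)
      = norm (p (Suc n) * X (Suc n) + q (Suc n) * X n)"
    unfolding norm_eq by (simp only: flip: W_step norm_power norm_mult)
  then show ?thesis
    using perturbation_bound[of n] mult_le_cancel_left_pos[of "norm \<alpha> ^ Suc n"] nonzero
    by (metis zero_less_norm_iff zero_less_power)
qed

lemma convergent_U: "convergent U" and convergent_W: "convergent W"
proof -
  \<comment> \<open>The increments of the sum are at most twice the rate, whence the factor 2 in the Gronwall bound.\<close>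
  define K where "K = (norm (U 0) + norm (W 0)) * exp (\<Sum>n. 2 * rate n)"
  have "norm (U n) + norm (W n) \<le> K" for n
    unfolding K_def
  proof (rule discrete_gronwall)
    show "norm (U (Suc n)) + norm (W (Suc n)) \<le> (1 + 2 * rate n) * (norm (U n) + norm (W n))" for n
      using U_increment[of n] W_increment[of n]
        norm_triangle_sub[of "U (Suc n)" "U n"] norm_triangle_sub[of "W (Suc n)" "W n"]
      by (simp add: algebra_simps)
  qed (auto simp: rate_nonneg intro!: summable_mult summable_rate)
  then have bound: "rate n * (norm (U n) + norm (W n)) \<le> K * rate n" for n
    by (metis mult.commute mult_left_mono rate_nonneg)
  have *: "summable (\<lambda>n. K * rate n)" by (intro summable_mult summable_rate)
  show "convergent U" "convergent W"
    by (rule convergent_if_summable_increments[OF *],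
        rule order_trans[OF U_increment bound] order_trans[OF W_increment bound])+
qed

lemma normalized_eq:
  "(\<alpha> - \<beta>) / \<beta> ^ Suc n * X (Suc n) = (\<alpha> / \<beta>) ^ Suc n * U n - W n"
  using nonzero X_Suc_eq[of n] by (simp add: field_simps)

text \<open>At \<open>n = 0\<close> the truncated predecessor \<open>n - 1\<close> gives a different quotient, so the sequences
  agree with \<open>U\<close> and \<open>W\<close> only from 1 on.\<close>

lemma tendsto_shift:
  "(\<lambda>n. (X (Suc n) - \<beta> * X (Suc (n - 1))) / \<alpha> ^ n) \<longlonglongrightarrow> lim U"
  "(\<lambda>n. (X (Suc n) - \<alpha> * X (Suc (n - 1))) / \<beta> ^ n) \<longlonglongrightarrow> lim W"
proof -
  have 1: "\<forall>\<^sub>F n in sequentially. U n = (X (Suc n) - \<beta> * X (Suc (n - 1))) / \<alpha> ^ n"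
    using eventually_gt_at_top[of 0] by eventually_elim (simp add: U_def)
  have 2: "\<forall>\<^sub>F n in sequentially. W n = (X (Suc n) - \<alpha> * X (Suc (n - 1))) / \<beta> ^ n"
    using eventually_gt_at_top[of 0] by eventually_elim (simp add: W_def)
  show "(\<lambda>n. (X (Suc n) - \<beta> * X (Suc (n - 1))) / \<alpha> ^ n) \<longlonglongrightarrow> lim U"
    using convergent_U Lim_transform_eventually[OF _ 1] by (simp add: convergent_LIMSEQ_iff)
  show "(\<lambda>n. (X (Suc n) - \<alpha> * X (Suc (n - 1))) / \<beta> ^ n) \<longlonglongrightarrow> lim W"
    using convergent_W Lim_transform_eventually[OF _ 2] by (simp add: convergent_LIMSEQ_iff)
qed

text \<open>Applied to numerators and denominators, this makes the approximants asymptotic to the values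
  of \<open>h\<close> at the powers of \<open>\<alpha> / \<beta>\<close>, in homogeneous coordinates.\<close>

lemma normalized_asymptotic:
  "(\<lambda>n. (\<alpha> - \<beta>) / \<beta> ^ Suc n * X (Suc n) - (lim U * (\<alpha> / \<beta>) ^ Suc n - lim W)) \<longlonglongrightarrow> 0"
proof -
  have "(\<lambda>n. U n - lim U) \<longlonglongrightarrow> 0" "(\<lambda>n. W n - lim W) \<longlonglongrightarrow> 0"
    using convergent_U convergent_W by (simp_all add: convergent_LIMSEQ_iff LIM_zero)
  have "(\<lambda>n. (\<alpha> / \<beta>) ^ Suc n * (U n - lim U)) \<longlonglongrightarrow> 0"
    by (rule Lim_null_comparison[OF _ tendsto_norm_zero[OF \<open>(\<lambda>n. U n - lim U) \<longlonglongrightarrow> 0\<close>]])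
       (use nonzero in \<open>simp add: norm_mult norm_power norm_divide norm_eq\<close>)
  from tendsto_diff[OF this \<open>(\<lambda>n. W n - lim W) \<longlonglongrightarrow> 0\<close>] show ?thesis
    unfolding normalized_eq by (simp add: algebra_simps)
qed

end

lemma cf_determinant:
  "cf_num A B (Suc n) * cf_den A B n - cf_num A B n * cf_den A B (Suc n)
     = - (\<Prod>i<n. - A (Suc i))"
proof (induction n)
  case (Suc n)
  have "cf_num A B (Suc (Suc n)) * cf_den A B (Suc n) - cf_num A B (Suc n) * cf_den A B (Suc (Suc n))
      = - A (Suc n) * (cf_num A B (Suc n) * cf_den A B n - cf_num A B n * cf_den A B (Suc n))"
    by (simp add: algebra_simps)
  then show ?case unfolding Suc.IH by simp
qed simp

lemma product_limit_nonzero: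
  fixes z :: "nat \<Rightarrow> complex"
  assumes "summable (\<lambda>n. norm (z n - 1))" "\<And>n. z n \<noteq> 0" "(\<lambda>n. \<Prod>i<n. z i) \<longlonglongrightarrow> L"
  shows "L \<noteq> 0"
proof -
  have "convergent_prod z"
    using assms(1) by (intro abs_convergent_prod_imp_convergent_prod summable_imp_abs_convergent_prod)
  then have "(\<lambda>n. \<Prod>i\<le>n. z i) \<longlonglongrightarrow> prodinf z" "prodinf z \<noteq> 0"
    using assms(2) by (auto intro: convergent_prod_LIMSEQ dest: prodinf_nonzero)
  moreover have "(\<lambda>n. \<Prod>i\<le>n. z i) \<longlonglongrightarrow> L"
    using LIMSEQ_Suc[OF assms(3)] by (simp add: lessThan_Suc_atMost)
  ultimately show ?thesis using LIMSEQ_unique by blast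
qed

text \<open>After a vanishing partial numerator every convergent is a multiple of one fixed
  vector, which leaves only one fraction, and infinity when the multiple is zero.\<close>

lemma two_values_after_zero:
  assumes "A (Suc N) = 0" "n \<ge> N"
  shows "approximant A B n \<in> {None, approximant A B N}"
proof -
  have "\<exists>l. cf_num A B (Suc n) = l * cf_num A B (Suc N) \<and> cf_den A B (Suc n) = l * cf_den A B (Suc N)"
    using \<open>n \<ge> N\<close>
  proof (induction n rule: less_induct)
    case (less n)
    consider "n = N" | "n = Suc N" | m where "n = Suc (Suc m)" "m \<ge> N"
    proof (cases "n \<le> Suc N")
      case False
      then show thesis using that(3)[of "n - 2"] by fastforce
    qed (use less.prems that in linarith)
    then show ?case
    proof cases
      case 1 then show ?thesis by (intro exI[of _ 1]) simp
    next
      case 2 then show ?thesis by (intro exI[of _ "B (Suc N)"]) (simp add: assms(1))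
    next
      case (3 m)
      obtain k where k: "cf_num A B (Suc m) = k * cf_num A B (Suc N)" "cf_den A B (Suc m) = k * cf_den A B (Suc N)"
        using less.IH[of m] 3 by auto
      obtain l where l: "cf_num A B (Suc (Suc m)) = l * cf_num A B (Suc N)" "cf_den A B (Suc (Suc m)) = l * cf_den A B (Suc N)"
        using less.IH[of "Suc m"] 3 by auto
      show ?thesis
        unfolding 3 cf_num.simps(3)[of A B "Suc m"] cf_den.simps(3)[of A B "Suc m"] k l
        by (intro exI[of _ "B (Suc (Suc m)) * l + A (Suc (Suc m)) * k"]) (simp add: algebra_simps)
    qed
  qed
  then show ?thesis by (auto simp: approximant_def sphere_quot_def)
qed

text \<open>
  The determinant of the transformation \<open>h\<close> is, up to a nonzero factor, the infinite product of
  the quotients of the partial numerators by \<open>- \<alpha> \<beta>\<close>. It converges absolutely, so it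
  vanishes only if a factor does.
\<close>

lemma limit_determinant_nonzero:
  assumes num: "perturbed_recurrence p q A B (cf_num A B) \<alpha> \<beta>"
    and den: "perturbed_recurrence p q A B (cf_den A B) \<alpha> \<beta>"
    and nz: "\<And>n. A (Suc n) \<noteq> 0"
    and a: "a = lim (perturbed_recurrence.U (cf_num A B) \<alpha> \<beta>)"
    and b: "b = - lim (perturbed_recurrence.W (cf_num A B) \<alpha> \<beta>)"
    and c: "c = lim (perturbed_recurrence.U (cf_den A B) \<alpha> \<beta>)"
    and d: "d = - lim (perturbed_recurrence.W (cf_den A B) \<alpha> \<beta>)"
  shows "a * d - b * c \<noteq> 0"
proof -
  interpret num: perturbed_recurrence p q A B "cf_num A B" \<alpha> \<beta> by (rule num)
  interpret den: perturbed_recurrence p q A B "cf_den A B" \<alpha> \<beta> by (rule den)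
  define z where "z n = - A (Suc n) / (\<alpha> * \<beta>)" for n
  have "norm (z n - 1) \<le> 1 / norm (\<alpha> * \<beta>) * (norm (p (Suc n)) + norm (q (Suc n)))" for n
  proof -
    have "z n - 1 = - q (Suc n) / (\<alpha> * \<beta>)"
      using num.nonzero by (simp add: z_def num.A field_simps)
    then show ?thesis by (simp add: norm_divide divide_right_mono)
  qed
  then have summ: "summable (\<lambda>n. norm (z n - 1))"
    by (intro summable_comparison_test'[OF summable_mult[OF num.summ, of "1 / norm (\<alpha> * \<beta>)"]])
       (simp only: real_norm_def abs_norm_cancel)
  have "(\<lambda>n. num.U n * den.W n - num.W n * den.U n) \<longlonglongrightarrow> a * (- d) - (- b) * c"
    unfolding a b c d minus_minus using num.convergent_U num.convergent_W den.convergent_U den.convergent_W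
    by (intro tendsto_intros) (simp_all add: convergent_LIMSEQ_iff)
  moreover have "num.U n * den.W n - num.W n * den.U n = (\<alpha> - \<beta>) * (\<Prod>i<n. z i)" for n
  proof -
    \<comment> \<open>The powers cancel, and the passage to eigenvectors multiplies the Casoratian by a constant determinant.\<close>
    have "(\<alpha> * \<beta>) ^ n * (num.U n * den.W n - num.W n * den.U n)
      = (\<beta> - \<alpha>) * (cf_num A B (Suc n) * cf_den A B n - cf_num A B n * cf_den A B (Suc n))"
      using num.nonzero
      by (simp add: num.U_def den.U_def num.W_def den.W_def power_mult_distrib divide_simps)
         (simp add: algebra_simps)
    also have "\<dots> = (\<alpha> - \<beta>) * (\<Prod>i<n. - A (Suc i))"
      unfolding cf_determinant by (simp add: algebra_simps)
    also have "\<dots> = (\<alpha> * \<beta>) ^ n * ((\<alpha> - \<beta>) * (\<Prod>i<n. z i))"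
      unfolding z_def prod_dividef using num.nonzero by simp
    finally show ?thesis using num.nonzero by simp
  qed
  ultimately have "(\<lambda>n. (\<alpha> - \<beta>) * (\<Prod>i<n. z i)) \<longlonglongrightarrow> - (a * d - b * c)" by simp
  from tendsto_mult[OF tendsto_const[of "1 / (\<alpha> - \<beta>)"] this]
  have "(\<lambda>n. \<Prod>i<n. z i) \<longlonglongrightarrow> - (a * d - b * c) / (\<alpha> - \<beta>)" using num.ne by simp
  from product_limit_nonzero[OF summ _ this] show ?thesis
    using nz num.nonzero num.ne by (auto simp: z_def)
qed


section \<open>Limits on the sphere and linear fractional images of circles\<close>

lemma sphere_limit_Some:
  assumes "limitin riemann_sphere F (Some x) sequentially" "e > 0"
  shows "\<forall>\<^sub>F n in sequentially. \<exists>y. F n = Some y \<and> dist y x < e"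
proof -
  have "openin riemann_sphere (Some ` ball x e)" by (simp add: riemann_sphere_def)
  with assms have "\<forall>\<^sub>F n in sequentially. F n \<in> Some ` ball x e" by (auto simp: limitin_def)
  then show ?thesis by eventually_elim (auto simp: dist_commute)
qed

lemma sphere_limit_None:
  assumes "limitin riemann_sphere F None sequentially"
  shows "\<forall>\<^sub>F n in sequentially. \<forall>y. F n = Some y \<longrightarrow> M < norm y"
proof -
  have "openin riemann_sphere (insert None (Some ` (UNIV - cball 0 M)))"
    unfolding riemann_sphere_def openin_Alexandroff_compactification
    by (intro disjI2 exI[of _ "cball 0 M"]) (simp add: compactin_euclidean_iff)
  with assms have "\<forall>\<^sub>F n in sequentially. F n \<in> insert None (Some ` (UNIV - cball 0 M))"
    by (auto simp: limitin_def)
  then show ?thesis by eventually_elim auto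
qed

text \<open>Both cases compare \<open>p\<close> and \<open>q\<close> in homogeneous form, so that no division by a vanishing
  denominator occurs before the limit is taken.\<close>

lemma sequential_closure_subset_image:
  assumes p: "(\<lambda>n. p n - (a * w n + b)) \<longlonglongrightarrow> 0" and q: "(\<lambda>n. q n - (c * w n + d)) \<longlonglongrightarrow> 0"
    and K: "compact K" "\<And>n. w n \<in> K" and det: "a * d - b * c \<noteq> 0"
  shows "sequential_closure (\<lambda>n. sphere_quot (p n) (q n)) \<subseteq> sphere_moebius a b c d ` Some ` K"
proof
  fix l assume "l \<in> sequential_closure (\<lambda>n. sphere_quot (p n) (q n))"
  then obtain r where r: "strict_mono r"
    and lim: "limitin riemann_sphere ((\<lambda>n. sphere_quot (p n) (q n)) \<circ> r) l sequentially"
    by (auto simp: sequential_closure_def)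
  from K obtain \<omega> s where \<omega>: "\<omega> \<in> K" and s: "strict_mono s" and "((w \<circ> r) \<circ> s) \<longlonglongrightarrow> \<omega>"
    using compact_def[of K] by (metis comp_apply)
  define k where "k = r \<circ> s"
  have k: "strict_mono k" using r s by (simp add: k_def strict_mono_o)
  have w: "(\<lambda>n. w (k n)) \<longlonglongrightarrow> \<omega>"
    using \<open>((w \<circ> r) \<circ> s) \<longlonglongrightarrow> \<omega>\<close> by (simp add: k_def o_def)
  define P where "P = a * \<omega> + b"
  define Q where "Q = c * \<omega> + d"
  have "(\<lambda>n. (p (k n) - (a * w (k n) + b)) + (a * w (k n) + b)) \<longlonglongrightarrow> 0 + P"
    unfolding P_def by (intro tendsto_intros w LIMSEQ_subseq_LIMSEQ[OF p k, unfolded o_def])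
  then have pk: "(\<lambda>n. p (k n)) \<longlonglongrightarrow> P" by simp
  have "(\<lambda>n. (q (k n) - (c * w (k n) + d)) + (c * w (k n) + d)) \<longlonglongrightarrow> 0 + Q"
    unfolding Q_def by (intro tendsto_intros w LIMSEQ_subseq_LIMSEQ[OF q k, unfolded o_def])
  then have qk: "(\<lambda>n. q (k n)) \<longlonglongrightarrow> Q" by simp
  have PQ: "a * Q - c * P \<noteq> 0" using det by (simp add: P_def Q_def algebra_simps)
  have limk: "limitin riemann_sphere (\<lambda>n. sphere_quot (p (k n)) (q (k n))) l sequentially"
    using limitin_subsequence[OF s lim] by (simp add: k_def o_def)
  have "l = sphere_quot P Q"
  proof (cases l)
    case (Some x)
    have le: "norm (P - x * Q) \<le> e * norm Q" if "e > 0" for e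
    proof (rule tendsto_le[OF sequentially_bot])
      show "(\<lambda>n. norm (p (k n) - x * q (k n))) \<longlonglongrightarrow> norm (P - x * Q)"
           "(\<lambda>n. e * norm (q (k n))) \<longlonglongrightarrow> e * norm Q"
        by (intro tendsto_intros pk qk)+
      show "\<forall>\<^sub>F n in sequentially. norm (p (k n) - x * q (k n)) \<le> e * norm (q (k n))"
        using sphere_limit_Some[OF limk[unfolded Some] that]
      proof eventually_elim
        case (elim n)
        then have nz: "q (k n) \<noteq> 0" and "dist (p (k n) / q (k n)) x < e"
          by (auto simp: sphere_quot_def split: if_splits)
        moreover have "p (k n) - x * q (k n) = (p (k n) / q (k n) - x) * q (k n)"
          using nz by (simp add: field_simps)
        ultimately show ?case by (simp add: dist_norm norm_mult mult_right_mono)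
      qed
    qed
    have "P = x * Q"
    proof (rule ccontr)
      assume "P \<noteq> x * Q"
      then have pos: "norm (P - x * Q) > 0" by simp
      \<comment> \<open>Adding 1 keeps the denominator positive even if \<open>Q = 0\<close>.\<close>
      define e where "e = norm (P - x * Q) / (2 * (norm Q + 1))"
      have "e > 0" unfolding e_def using pos by (intro divide_pos_pos mult_pos_pos add_nonneg_pos) auto
      have "e * norm Q \<le> e * (norm Q + 1)" using \<open>e > 0\<close> by simp
      also have "\<dots> = norm (P - x * Q) / 2"
        unfolding e_def using add_nonneg_pos[OF norm_ge_zero[of Q] zero_less_one]
        by (simp add: divide_simps del: distrib_left_numeral)
      finally show False using le[OF \<open>e > 0\<close>] pos by simp
    qed
    then show ?thesis using PQ Some by (auto simp: sphere_quot_def)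
  next
    case None
    have le: "M * norm Q \<le> norm P" if "M > 0" for M
    proof (rule tendsto_le[OF sequentially_bot])
      show "(\<lambda>n. norm (p (k n))) \<longlonglongrightarrow> norm P" "(\<lambda>n. M * norm (q (k n))) \<longlonglongrightarrow> M * norm Q"
        by (intro tendsto_intros pk qk)+
      show "\<forall>\<^sub>F n in sequentially. M * norm (q (k n)) \<le> norm (p (k n))"
        using sphere_limit_None[OF limk[unfolded None], of M]
      proof eventually_elim
        case (elim n)
        then show ?case
          by (cases "q (k n) = 0") (auto simp: sphere_quot_def norm_divide pos_less_divide_eq)
      qed
    qed
    have "Q = 0"
    proof (rule ccontr)
      assume "Q \<noteq> 0"
      then have Q0: "norm Q > 0" by simp
      have "(norm P + 1) / norm Q * norm Q \<le> norm P"
        by (rule le) (use Q0 in \<open>simp add: add_nonneg_pos\<close>)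
      then show False using Q0 by simp
    qed
    then show ?thesis using None by (simp add: sphere_quot_def)
  qed
  also have "\<dots> = sphere_moebius a b c d (Some \<omega>)" by (simp add: P_def Q_def)
  finally show "l \<in> sphere_moebius a b c d ` Some ` K" using \<omega> by blast
qed

text \<open>This excludes a vanishing partial numerator, after which only two values occur, while a line
  is infinite.\<close>

lemma sequential_closure_subset_finite:
  assumes "finite F" "\<forall>\<^sub>F n in sequentially. f n \<in> F"
  shows "sequential_closure f \<subseteq> F"
proof
  fix l assume "l \<in> sequential_closure f"
  then obtain r where r: "strict_mono r" and lim: "limitin riemann_sphere (f \<circ> r) l sequentially"
    by (auto simp: sequential_closure_def)
  have ev: "\<forall>\<^sub>F n in sequentially. f (r n) \<in> F"
    using eventually_subseq[OF r assms(2)] .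
  show "l \<in> F"
  proof (rule ccontr)
    assume l: "l \<notin> F"
    show False
    proof (cases l)
      case None
      define M where "M = Max (insert 0 ((norm \<circ> the) ` F))"
      have "\<forall>\<^sub>F n in sequentially. False"
        using ev sphere_limit_None[OF lim[unfolded None], of M]
      proof eventually_elim
        case (elim n)
        then obtain y where y: "f (r n) = Some y" using l None by (metis not_None_eq)
        then have "norm y \<le> M" unfolding M_def using elim(1) assms(1)
          by (intro Max_ge) (auto intro!: image_eqI[of _ _ "Some y"])
        then show False using elim(2) y by auto
      qed
      then show False by simp
    next
      case (Some x)
      have "finite (the ` F)" using assms by simp
      then obtain e where e: "e > 0" "\<And>y. y \<in> the ` F \<Longrightarrow> y \<noteq> x \<Longrightarrow> e \<le> dist x y"
        using finite_set_avoid[of "the ` F" x] by blast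
      have "\<forall>\<^sub>F n in sequentially. False"
        using ev sphere_limit_Some[OF lim[unfolded Some] \<open>e > 0\<close>]
      proof eventually_elim
        case (elim n)
        then obtain y where y: "f (r n) = Some y" "dist y x < e" by auto
        then have "y \<in> the ` F" using elim(1) by (metis image_eqI option.sel)
        then have "y = x" using e(2)[of y] y(2) by (auto simp: dist_commute)
        then show False using y elim(1) l Some by simp
      qed
      then show False by simp
    qed
  qed
qed

lemma infinite_sphere_line:
  assumes "v \<noteq> 0"
  shows "infinite (sphere_line z v)"
proof -
  have "inj (\<lambda>t::real. Some (z + of_real t * v))" using assms by (auto simp: inj_def)
  then have "infinite (range (\<lambda>t::real. Some (z + of_real t * v)))"
    using infinite_UNIV_char_0 by (metis finite_imageD)
  moreover have "range (\<lambda>t::real. Some (z + of_real t * v)) \<subseteq> sphere_line z v"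
    by (auto simp: sphere_line_def)
  ultimately show ?thesis using finite_subset by blast
qed

text \<open>
  Turning the pole \<open>- d / c\<close> to \<open>-1\<close> and halving the angle makes the denominator a multiple of
  \<open>cos\<close> and the numerator a linear combination of \<open>cos\<close> and \<open>sin\<close>.
\<close>

lemma moebius_circle_tan:
  fixes a b c d :: complex
  assumes "c \<noteq> 0" "d / c = cis \<theta>1"
  defines "\<psi> \<equiv> \<lambda>\<theta>. (\<theta> - \<theta>1) / 2"
  shows "sphere_moebius a b c d (Some (cis \<theta>)) =
     (if cos (\<psi> \<theta>) = 0 then None
      else Some ((a / c + b / d) / 2 - (a / c - b / d) / (2 * \<i>) * of_real (tan (\<psi> \<theta>))))"
proof -
  define x where "x = \<psi> \<theta>"
  have d: "d = c * cis \<theta>1" "d \<noteq> 0" using assms(1,2) by (auto simp: field_simps)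
  have "\<theta> = \<theta>1 + x + x" by (simp add: x_def \<psi>_def)
  then have cis: "cis \<theta> = cis \<theta>1 * cis x * cis x" by (simp add: cis_mult)
  have u: "cis x * cis (- x) = 1" by (simp add: cis_mult)
  have cs: "of_real (cos x) = (cis x + cis (- x)) / 2" "of_real (sin x) = (cis x - cis (- x)) / (2 * \<i>)"
    by (simp_all add: complex_eq_iff)
  have "c * cis \<theta> + d = c * cis \<theta>1 * cis x * (cis x + cis (- x))"
    unfolding cis d using u by (simp add: algebra_simps)
  then have den: "c * cis \<theta> + d = d * cis x * (2 * of_real (cos x))" by (simp add: cs d)
  have num: "a * cis \<theta> + b = d * cis x * (a / c * cis x + b / d * cis (- x))"
    unfolding cis using u d assms(1) by (simp add: field_simps)
  show ?thesis
  proof (cases "cos x = 0")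
    case True
    then show ?thesis using den by (simp add: sphere_quot_def x_def)
  next
    case False
    have "(a * cis \<theta> + b) / (c * cis \<theta> + d) = (a / c * cis x + b / d * cis (- x)) / (2 * of_real (cos x))"
      unfolding num den using d by simp
    also have "\<dots> = ((a / c + b / d) * of_real (cos x) + \<i> * (a / c - b / d) * of_real (sin x)) / (2 * of_real (cos x))"
    proof -
      have "X * cis x + Y * cis (- x) = (X + Y) * of_real (cos x) + \<i> * (X - Y) * of_real (sin x)" for X Y
        by (simp add: cs field_simps)
      from this[of "a / c" "b / d"] show ?thesis by simp
    qed
    also have "\<dots> = (a / c + b / d) / 2 - (a / c - b / d) / (2 * \<i>) * of_real (tan x)"
      using False by (simp add: tan_def field_simps)
    finally show ?thesis using False den d by (simp add: sphere_quot_def x_def)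
  qed
qed

text \<open>Infinity is attained on the circle, so the pole \<open>- d / c\<close> has modulus 1; the two fractions
  differ by a multiple of the determinant.\<close>

lemma moebius_circle_line_coefficients:
  fixes a b c d :: complex
  assumes det: "a * d - b * c \<noteq> 0" and mem: "None \<in> sphere_moebius a b c d ` Some ` sphere 0 1"
  shows "c \<noteq> 0" "d \<noteq> 0" "norm (d / c) = 1" "a / c \<noteq> b / d"
proof -
  from mem obtain w where w: "norm w = 1" "c * w + d = 0"
    by (auto simp: sphere_quot_def split: if_splits)
  from w have d: "d = - (c * w)" by (simp add: add_eq_0_iff)
  then show "c \<noteq> 0" using det by auto
  then show "d \<noteq> 0" using d w by auto
  show "norm (d / c) = 1" using \<open>c \<noteq> 0\<close> w d by (simp add: norm_divide norm_mult)
  show "a / c \<noteq> b / d" using det \<open>c \<noteq> 0\<close> \<open>d \<noteq> 0\<close> by (simp add: field_simps)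
qed

text \<open>By the tangent formula the finite values on the circle lie on one line. Two points of
  \<open>sphere_line z v\<close> suffice to express its parameter through the tangent.\<close>

lemma line_within_moebius_circle:
  fixes a b c d :: complex
  assumes v: "v \<noteq> 0" and c: "c \<noteq> 0" "d / c = cis \<theta>1"
    and sub: "sphere_line z v \<subseteq> sphere_moebius a b c d ` Some ` sphere 0 1"
  obtains t0 \<kappa> :: real where "(a / c + b / d) / 2 = z + of_real t0 * v"
    "- ((a / c - b / d) / (2 * \<i>)) = of_real \<kappa> * v" "\<kappa> \<noteq> 0"
proof -
  define x0 where "x0 = (a / c + b / d) / 2"
  define \<delta> where "\<delta> = (a / c - b / d) / (2 * \<i>)"
  have ex: "\<exists>\<tau>::real. z + of_real t * v = x0 - \<delta> * of_real \<tau>" for t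
  proof -
    have "Some (z + of_real t * v) \<in> sphere_line z v" by (auto simp: sphere_line_def)
    then obtain w where w: "norm w = 1" "Some (z + of_real t * v) = sphere_moebius a b c d (Some w)"
      using sub by fastforce
    then obtain \<theta> where "w = cis \<theta>" by (metis complex_norm_eq_1_exp cis_conv_exp)
    then show ?thesis using w(2) moebius_circle_tan[OF c, of a b \<theta>]
      by (auto simp: x0_def \<delta>_def split: if_splits)
  qed
  obtain \<tau>0 \<tau>1 :: real where \<tau>: "z = x0 - \<delta> * of_real \<tau>0" "z + v = x0 - \<delta> * of_real \<tau>1"
    using ex[of 0] ex[of 1] by (metis add.right_neutral mult_1 mult_zero_left of_real_0 of_real_1)
  then have "v = (x0 - \<delta> * of_real \<tau>1) - (x0 - \<delta> * of_real \<tau>0)" by (metis add_diff_cancel_left')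
  then have v': "v = \<delta> * (of_real \<tau>0 - of_real \<tau>1)" by (simp add: algebra_simps)
  with v have "\<tau>0 \<noteq> \<tau>1" by auto
  then have ne: "of_real \<tau>0 - of_real \<tau>1 \<noteq> (0::complex)" by simp
  show thesis
  proof (rule that)
    show "(a / c + b / d) / 2 = z + of_real (\<tau>0 / (\<tau>0 - \<tau>1)) * v"
      unfolding v' x0_def[symmetric] using ne \<tau>(1) by simp
    show "- ((a / c - b / d) / (2 * \<i>)) = of_real (- 1 / (\<tau>0 - \<tau>1)) * v"
      unfolding v' \<delta>_def[symmetric] using ne by simp
    show "- 1 / (\<tau>0 - \<tau>1) \<noteq> 0" using \<open>\<tau>0 \<noteq> \<tau>1\<close> by simp
  qed
qed


section \<open>The tangent of a uniform angle is Cauchy distributed\<close>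

definition standard_cauchy :: "real measure" where
  "standard_cauchy = density lborel (\<lambda>t. ennreal (1 / (pi * (1 + t\<^sup>2))))"

lemma DERIV_arctan_cauchy: "((\<lambda>x. arctan x / pi) has_real_derivative 1 / (pi * (1 + x\<^sup>2))) (at x)"
proof -
  have "((\<lambda>x. arctan x / pi) has_real_derivative inverse (1 + x\<^sup>2) / pi) (at x)"
    by (rule DERIV_cdivide[OF DERIV_arctan])
  then show ?thesis by (simp add: divide_inverse mult.commute)
qed

lemma emeasure_standard_cauchy_atLeast:
  "emeasure standard_cauchy {x..} = ennreal (1 / 2 - arctan x / pi)"
proof -
  have "((\<lambda>x. arctan x / pi) \<longlongrightarrow> (pi / 2) / pi) at_top"
    by (intro tendsto_intros tendsto_arctan_at_top) simp
  then have lim: "((\<lambda>x. arctan x / pi) \<longlongrightarrow> 1 / 2) at_top" by simp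
  have "(\<integral>\<^sup>+t. ennreal (1 / (pi * (1 + t\<^sup>2))) * indicator {x..} t \<partial>lborel) = ennreal (1 / 2 - arctan x / pi)"
    by (rule nn_integral_FTC_atLeast[OF _ DERIV_arctan_cauchy _ lim]) (auto intro!: add_nonneg_nonneg)
  then show ?thesis by (simp add: standard_cauchy_def emeasure_density)
qed

text \<open>Reflection reduces the lower tail to the upper one.\<close>

lemma emeasure_standard_cauchy_atMost:
  "emeasure standard_cauchy {..x} = ennreal (1 / 2 + arctan x / pi)"
proof -
  have "emeasure standard_cauchy {..x}
      = (\<integral>\<^sup>+t. ennreal (1 / (pi * (1 + t\<^sup>2))) * indicator {..x} t \<partial>lborel)"
    by (simp add: standard_cauchy_def emeasure_density)
  also have "\<dots> = (\<integral>\<^sup>+t. ennreal (1 / (pi * (1 + t\<^sup>2))) * indicator {-x..} t \<partial>lborel)"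
    by (subst nn_integral_real_affine[where c = "-1" and t = 0])
       (auto intro!: nn_integral_cong split: split_indicator)
  also have "\<dots> = emeasure standard_cauchy {-x..}"
    by (simp add: standard_cauchy_def emeasure_density)
  finally show ?thesis by (simp add: emeasure_standard_cauchy_atLeast arctan_minus)
qed

lemma finite_borel_measure_standard_cauchy: "finite_borel_measure standard_cauchy"
proof (intro finite_borel_measure.intro finite_borel_measure_axioms.intro finite_measureI)
  have "emeasure standard_cauchy UNIV \<le> emeasure standard_cauchy {..0} + emeasure standard_cauchy {0..}"
    by (rule order_trans[OF _ emeasure_subadditive]) (auto simp: standard_cauchy_def intro!: emeasure_mono)
  also have "\<dots> = ennreal 1"
    unfolding emeasure_standard_cauchy_atLeast emeasure_standard_cauchy_atMost
    by (subst ennreal_plus[symmetric]) auto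
  also have "\<dots> < \<infinity>" by simp
  finally show "emeasure standard_cauchy (space standard_cauchy) \<noteq> \<infinity>"
    by (simp add: standard_cauchy_def)
qed (simp add: standard_cauchy_def)

abbreviation uniform_angle :: "real measure" where
  "uniform_angle \<equiv> uniform_measure lborel {0..<2 * pi}"

lemma prob_space_uniform_angle: "prob_space uniform_angle"
  by (rule prob_space_uniform_measure) auto

lemma AE_uniform_angle: "AE x in lborel. P x \<Longrightarrow> AE x in uniform_angle. P x"
  by (rule AE_uniform_measureI) auto

lemma AE_cos_half_nonzero: "AE x in lborel. cos ((x - t) / 2) \<noteq> (0::real)"
proof -
  have "{x::real. cos ((x - t) / 2) = 0} \<subseteq> range (\<lambda>i::int. t + of_int i * pi)"
  proof
    fix x :: real assume "x \<in> {x. cos ((x - t) / 2) = 0}"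
    then obtain i where "(x - t) / 2 = of_int i * (pi / 2)" by (auto simp: cos_zero_iff_int)
    then have "x = t + of_int i * pi" by simp
    then show "x \<in> range (\<lambda>i::int. t + of_int i * pi)" by blast
  qed
  then have "countable {x::real. cos ((x - t) / 2) = 0}"
    by (rule countable_subset) simp
  from AE_not_in[OF countable_imp_null_set_lborel[OF this]] show ?thesis by simp
qed

lemma borel_measurable_tan_half [measurable]: "(\<lambda>x. tan ((x - t) / 2) :: real) \<in> borel_measurable borel"
  unfolding tan_def by measurable

lemma tan_le_iff:
  assumes "- (pi / 2) < y" "y < pi / 2"
  shows "tan y \<le> x \<longleftrightarrow> y \<le> arctan x"
  using arctan_le_iff[of "tan y" x] arctan_tan[OF assms] by simp

text \<open>
  As \<open>\<theta>\<close> runs through \<open>[0, 2 \<pi>)\<close>, the half angle runs through an interval of length \<open>\<pi>\<close>, and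
  the pole of the tangent at \<open>\<pi> / 2\<close> splits it into two. The part beyond the pole is the part of
  \<open>(- \<pi> / 2, \<pi> / 2)\<close> missing from the first one, shifted by the period.
\<close>

lemma tan_half_angle_distr:
  assumes t: "- pi < t" "t \<le> pi"
  shows "distr uniform_angle borel (\<lambda>\<theta>. tan ((\<theta> - t) / 2)) = standard_cauchy"
proof (rule cdf_unique')
  interpret prob_space uniform_angle by (rule prob_space_uniform_angle)
  show "finite_borel_measure (distr uniform_angle borel (\<lambda>\<theta>. tan ((\<theta> - t) / 2)))"
    by (intro finite_borel_measure.intro finite_borel_measure_axioms.intro prob_space.finite_measure
        prob_space_distr) auto
  show "finite_borel_measure standard_cauchy" by (rule finite_borel_measure_standard_cauchy)
  show "cdf (distr uniform_angle borel (\<lambda>\<theta>. tan ((\<theta> - t) / 2))) = cdf standard_cauchy"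
  proof
    fix x
    define S where "S = {0..<2 * pi} \<inter> {\<theta>. tan ((\<theta> - t) / 2) \<le> x}"
    define \<gamma> where "\<gamma> = arctan x"
    have \<gamma>: "- (pi / 2) < \<gamma>" "\<gamma> < pi / 2" unfolding \<gamma>_def by (rule arctan_lbound arctan_ubound)+
    have S[measurable]: "S \<in> sets lborel" unfolding S_def by measurable
    \<comment> \<open>\<open>I\<close> differs from \<open>S\<close> at most at the poles \<open>t \<plusminus> \<pi>\<close>, where the tangent has the default value 0.\<close>
    define I where "I = (if t + 2 * \<gamma> \<ge> 0 then {0..t + 2 * \<gamma>} \<union> {t + pi<..<2 * pi}
                         else {t + pi<..t + 2 * pi + 2 * \<gamma>})"
    have before: "tan ((\<theta> - t) / 2) \<le> x \<longleftrightarrow> \<theta> \<le> t + 2 * \<gamma>" if "t - pi < \<theta>" "\<theta> < t + pi" for \<theta>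
      using tan_le_iff[of "(\<theta> - t) / 2" x] that by (auto simp: \<gamma>_def)
    have after: "tan ((\<theta> - t) / 2) \<le> x \<longleftrightarrow> \<theta> \<le> t + 2 * pi + 2 * \<gamma>" if "t + pi < \<theta>" "\<theta> < 2 * pi" for \<theta>
    proof -
      have "tan ((\<theta> - t) / 2) = tan ((\<theta> - t) / 2 - pi)" using tan_periodic_pi[of "(\<theta> - t) / 2 - pi"] by simp
      moreover have "- (pi / 2) < (\<theta> - t) / 2 - pi" "(\<theta> - t) / 2 - pi < pi / 2"
        using that t by (auto simp: field_simps)
      ultimately show ?thesis
        using tan_le_iff[of "(\<theta> - t) / 2 - pi" x] by (auto simp: \<gamma>_def field_simps)
    qed
    have SI: "\<theta> \<in> S \<longleftrightarrow> \<theta> \<in> I" if poles: "\<theta> \<noteq> t + pi" "\<theta> \<noteq> t - pi" for \<theta>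
    proof -
      consider "\<theta> < 0" | "\<theta> \<ge> 2 * pi" | "0 \<le> \<theta>" "\<theta> < t + pi" "\<theta> < 2 * pi" | "0 \<le> \<theta>" "t + pi < \<theta>" "\<theta> < 2 * pi"
        using poles by linarith
      then show ?thesis
      proof cases
        case 3
        then have "t - pi < \<theta>" using t poles by linarith
        then show ?thesis using 3 before[of \<theta>] \<gamma> by (auto simp: S_def I_def)
      next
        case 4
        then show ?thesis using after[of \<theta>] t \<gamma> by (auto simp: S_def I_def)
      qed (use t \<gamma> in \<open>auto simp: S_def I_def\<close>)
    qed
    have "AE \<theta> in lborel. \<theta> \<in> S \<longleftrightarrow> \<theta> \<in> I"
      using AE_lborel_singleton[of "t + pi"] AE_lborel_singleton[of "t - pi"]
      by eventually_elim (rule SI)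
    then have "emeasure lborel S = emeasure lborel I"
      using S by (intro emeasure_eq_AE) (auto simp: I_def)
    also have "\<dots> = ennreal (pi + 2 * \<gamma>)"
    proof (cases "t + 2 * \<gamma> \<ge> 0")
      case True
      have "emeasure lborel I = emeasure lborel {0..t + 2 * \<gamma>} + emeasure lborel {t + pi<..<2 * pi}"
        unfolding I_def using True \<gamma> by (simp only: if_True, intro plus_emeasure[symmetric]) auto
      then show ?thesis using True t by (simp flip: ennreal_plus)
    next
      case False
      then show ?thesis using \<gamma> by (simp add: I_def)
    qed
    finally have "emeasure lborel S = ennreal (pi + 2 * \<gamma>)" .
    then have "measure lborel S / (2 * pi) = 1 / 2 + \<gamma> / pi" using \<gamma> by (simp add: measure_def field_simps)
    moreover have "cdf (distr uniform_angle borel (\<lambda>\<theta>. tan ((\<theta> - t) / 2))) x = measure lborel S / (2 * pi)"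
    proof -
      have "cdf (distr uniform_angle borel (\<lambda>\<theta>. tan ((\<theta> - t) / 2))) x
          = measure uniform_angle {\<theta>. tan ((\<theta> - t) / 2) \<le> x}"
        unfolding cdf_def by (subst measure_distr) (auto simp: vimage_def)
      also have "\<dots> = measure lborel S / (2 * pi)"
        unfolding S_def by (subst measure_uniform_measure) auto
      finally show ?thesis .
    qed
    moreover have "cdf standard_cauchy x = 1 / 2 + \<gamma> / pi"
      using \<gamma> by (simp add: cdf_def measure_def emeasure_standard_cauchy_atMost \<gamma>_def field_simps)
    ultimately show "cdf (distr uniform_angle borel (\<lambda>\<theta>. tan ((\<theta> - t) / 2))) x = cdf standard_cauchy x"
      by simp
  qed
qed

lemma cauchy_density_nonneg: "s > 0 \<Longrightarrow> 0 \<le> cauchy_density x0 s x"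
  by (simp add: cauchy_density_def)

lemma borel_measurable_cauchy_density [measurable]: "cauchy_density x0 s \<in> borel_measurable borel"
  unfolding cauchy_density_def[abs_def] by measurable

lemma affine_standard_cauchy:
  assumes "\<kappa> \<noteq> 0"
  shows "distr standard_cauchy borel (\<lambda>t. t0 + \<kappa> * t) = density lborel (\<lambda>t. ennreal (cauchy_density t0 \<bar>\<kappa>\<bar> t))"
proof -
  have "density lborel (\<lambda>t. ennreal (cauchy_density t0 \<bar>\<kappa>\<bar> t))
      = density (distr lborel borel (\<lambda>t. t0 + \<kappa> * t)) (\<lambda>t. ennreal \<bar>\<kappa>\<bar> * ennreal (cauchy_density t0 \<bar>\<kappa>\<bar> t))"
    by (subst lborel_real_affine[OF assms, of t0]) (subst density_density_eq, auto)
  also have "\<dots> = distr (density lborel (\<lambda>t. ennreal \<bar>\<kappa>\<bar> * ennreal (cauchy_density t0 \<bar>\<kappa>\<bar> (t0 + \<kappa> * t)))) borel (\<lambda>t. t0 + \<kappa> * t)"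
    by (rule density_distr) auto
  also have "(\<lambda>t. ennreal \<bar>\<kappa>\<bar> * ennreal (cauchy_density t0 \<bar>\<kappa>\<bar> (t0 + \<kappa> * t))) = (\<lambda>t. ennreal (1 / (pi * (1 + t\<^sup>2))))"
  proof
    fix t :: real
    have nz: "\<kappa>\<^sup>2 + (\<kappa> * t)\<^sup>2 = \<kappa>\<^sup>2 * (1 + t\<^sup>2)" by (simp add: algebra_simps power_mult_distrib)
    have "\<bar>\<kappa>\<bar> * cauchy_density t0 \<bar>\<kappa>\<bar> (t0 + \<kappa> * t) = \<kappa>\<^sup>2 / (pi * (\<kappa>\<^sup>2 * (1 + t\<^sup>2)))"
      unfolding cauchy_density_def nz[symmetric] by (simp add: power2_eq_square add.commute)
    also have "\<dots> = 1 / (pi * (1 + t\<^sup>2))" using assms by simp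
    finally show "ennreal \<bar>\<kappa>\<bar> * ennreal (cauchy_density t0 \<bar>\<kappa>\<bar> (t0 + \<kappa> * t)) = ennreal (1 / (pi * (1 + t\<^sup>2)))"
      by (simp flip: ennreal_mult')
  qed
  finally show ?thesis by (simp add: standard_cauchy_def)
qed


section \<open>The limiting measure on a line\<close>

lemma sets_sphere_borel: "openin riemann_sphere U \<Longrightarrow> U \<in> sets sphere_borel"
  and space_sphere_borel [simp]: "space sphere_borel = UNIV"
  by (auto simp: sphere_borel_def intro!: in_measure_of)

lemma openin_image_Some: "openin riemann_sphere (Some ` S) \<longleftrightarrow> open S"
  by (simp add: riemann_sphere_def)

lemma open_vimage_Some: "openin riemann_sphere U \<Longrightarrow> open (Some -` U)"
  using openin_continuous_map_preimage[OF continuous_map_Some[of euclidean], of U]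
  by (simp add: riemann_sphere_def vimage_def)

lemma None_in_sets_sphere_borel: "{None} \<in> sets sphere_borel"
proof -
  have "{None :: complex option} = UNIV - Some ` UNIV" by (auto simp: image_iff)
  also have "\<dots> = space sphere_borel - Some ` UNIV" by simp
  also have "\<dots> \<in> sets sphere_borel"
    by (intro sets.compl_sets sets_sphere_borel) (simp add: openin_image_Some)
  finally show ?thesis .
qed

lemma measurable_into_sphere:
  assumes [measurable]: "Measurable.pred M S" "g \<in> borel_measurable M"
  shows "(\<lambda>x. if S x then None else Some (g x)) \<in> measurable M sphere_borel"
  unfolding sphere_borel_def
proof (rule measurable_measure_of)
  fix U assume "U \<in> {U. openin riemann_sphere U}"
  then have [measurable]: "Some -` U \<in> sets borel" by (auto intro: borel_open open_vimage_Some)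
  have "(\<lambda>x. if S x then None else Some (g x)) -` U \<inter> space M
      = {x \<in> space M. (S x \<and> None \<in> U) \<or> (\<not> S x \<and> g x \<in> Some -` U)}"
    by (auto split: if_splits)
  also have "\<dots> \<in> sets M" by measurable
  finally show "(\<lambda>x. if S x then None else Some (g x)) -` U \<inter> space M \<in> sets M" .
qed auto

lemma measurable_from_sphere:
  fixes r :: "complex \<Rightarrow> real"
  assumes [measurable]: "r \<in> borel_measurable borel"
  shows "(\<lambda>y. case y of None \<Rightarrow> k | Some w \<Rightarrow> r w) \<in> borel_measurable sphere_borel"
proof -
  define proj :: "complex option \<Rightarrow> complex" where "proj y = (case y of None \<Rightarrow> 0 | Some w \<Rightarrow> w)" for y
  have [measurable]: "proj \<in> borel_measurable sphere_borel"
  proof (rule borel_measurableI)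
    fix S :: "complex set" assume "open S"
    have "proj -` S \<inter> space sphere_borel = Some ` S \<union> (if 0 \<in> S then {None} else {})"
      by (auto simp: proj_def split: option.splits if_splits)
    also have "\<dots> \<in> sets sphere_borel"
      using sets_sphere_borel[of "Some ` S"] \<open>open S\<close> None_in_sets_sphere_borel
      by (intro sets.Un) (auto simp: openin_image_Some)
    finally show "proj -` S \<inter> space sphere_borel \<in> sets sphere_borel" .
  qed
  have [measurable]: "Measurable.pred sphere_borel (\<lambda>y. y = None)"
    using None_in_sets_sphere_borel by (simp add: pred_def)
  have "(\<lambda>y. if y = None then k else r (proj y)) \<in> borel_measurable sphere_borel" by measurable
  also have "(\<lambda>y. if y = None then k else r (proj y)) = (\<lambda>y. case y of None \<Rightarrow> k | Some w \<Rightarrow> r w)"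
    by (auto simp: proj_def split: option.splits)
  finally show ?thesis .
qed

text \<open>The points where \<open>r\<close> avoids a neighbourhood of 0 form a compact set, whose complement is a
  neighbourhood of infinity.\<close>

lemma continuous_map_sphere_vanishing:
  fixes r :: "complex \<Rightarrow> real"
  assumes cont: "continuous_on UNIV r" and lim: "(r \<longlongrightarrow> 0) at_infinity"
  shows "continuous_map riemann_sphere euclideanreal (\<lambda>y. case y of None \<Rightarrow> 0 | Some w \<Rightarrow> r w)"
    (is "continuous_map _ _ ?\<rho>")
proof -
  have top: "topspace riemann_sphere = UNIV"
    by (simp add: riemann_sphere_def UNIV_option_conv)
  have "openin riemann_sphere {y. ?\<rho> y \<in> V}" if "open V" for V
  proof (cases "0 \<in> V")
    case False
    then have "{y. ?\<rho> y \<in> V} = Some ` (r -` V)"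
      by (auto split: option.splits)
    then show ?thesis
      using cont \<open>open V\<close> by (simp add: openin_image_Some open_vimage)
  next
    case True
    define C where "C = r -` (- V)"
    have "closed C" unfolding C_def using cont \<open>open V\<close> by (intro closed_vimage) auto
    moreover have "bounded C"
    proof -
      have "\<forall>\<^sub>F w in at_infinity. r w \<in> V" using topological_tendstoD[OF lim \<open>open V\<close> True] .
      then obtain b where "\<And>w. b \<le> norm w \<Longrightarrow> r w \<in> V" by (auto simp: eventually_at_infinity)
      then have "norm w \<le> b" if "w \<in> C" for w using that by (force simp: C_def)
      then show ?thesis by (rule boundedI)
    qed
    ultimately have "compact C" by (simp add: compact_eq_bounded_closed)
    have "{y. ?\<rho> y \<in> V} = insert None (Some ` (UNIV - C))"
    proof -
      have "y \<in> {y. ?\<rho> y \<in> V} \<longleftrightarrow> y \<in> insert None (Some ` (UNIV - C))" for y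
        using True by (cases y) (auto simp: C_def)
      then show ?thesis by blast
    qed
    then show ?thesis
      unfolding riemann_sphere_def openin_Alexandroff_compactification
      using \<open>compact C\<close> \<open>closed C\<close> by (intro disjI2 exI[of _ C]) (simp add: compactin_euclidean_iff)
  qed
  then show ?thesis by (auto simp: continuous_map_def top)
qed

lemma limit_measure_eq_distr:
  assumes h: "(\<lambda>z. h (Some z)) \<in> measurable borel sphere_borel"
  shows "limit_measure h = distr uniform_angle sphere_borel (\<lambda>\<theta>. h (Some (cis \<theta>)))"
proof (rule measure_eqI)
  note h[measurable]
  have cis: "cis \<in> borel_measurable borel"
    by (intro borel_measurable_continuous_onI continuous_intros)
  note cis[measurable]
  have hc: "(\<lambda>\<theta>. h (Some (cis \<theta>))) \<in> measurable borel sphere_borel"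
    by measurable
  have cisR: "cis \<in> measurable (restrict_space lborel {0..<2 * pi}) borel"
    by (rule measurable_restrict_space1) simp
  fix E assume "E \<in> sets (limit_measure h)"
  then have E: "E \<in> sets sphere_borel" by (simp add: limit_measure_def)
  define T where "T = {\<theta>. h (Some (cis \<theta>)) \<in> E}"
  have T: "T \<in> sets borel" using measurable_sets[OF hc E] by (simp add: T_def vimage_def)
  have hE: "(\<lambda>z. h (Some z)) -` E \<in> sets borel" using measurable_sets[OF h E] by simp
  have "emeasure (limit_measure h) E
      = ennreal (1 / (2 * pi)) * emeasure circle_arc_length ((\<lambda>z. h (Some z)) -` E)"
    unfolding limit_measure_def
    by (subst emeasure_distr) (use h E hE in \<open>auto simp: circle_arc_length_def\<close>)
  also have "emeasure circle_arc_length ((\<lambda>z. h (Some z)) -` E)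
      = emeasure (restrict_space lborel {0..<2 * pi}) (T \<inter> {0..<2 * pi})"
    unfolding circle_arc_length_def using hE
    by (subst emeasure_distr[OF cisR]) (auto simp: T_def vimage_def space_restrict_space)
  also have "\<dots> = emeasure lborel (T \<inter> {0..<2 * pi})"
    using T by (subst emeasure_restrict_space) auto
  also have "ennreal (1 / (2 * pi)) * emeasure lborel (T \<inter> {0..<2 * pi})
      = emeasure uniform_angle T"
    using T by (simp add: divide_ennreal_def Int_commute mult.commute inverse_ennreal inverse_eq_divide)
  also have "\<dots> = emeasure (distr uniform_angle sphere_borel (\<lambda>\<theta>. h (Some (cis \<theta>)))) E"
    using hc E by (subst emeasure_distr) (auto simp: T_def vimage_def)
  finally show "emeasure (limit_measure h) E = emeasure (distr uniform_angle sphere_borel (\<lambda>\<theta>. h (Some (cis \<theta>)))) E" .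
qed (simp add: limit_measure_def)

lemma measurable_moebius: "(\<lambda>z. sphere_moebius a b c d (Some z)) \<in> measurable borel sphere_borel"
  unfolding sphere_moebius.simps sphere_quot_def by (rule measurable_into_sphere) measurable

text \<open>
  Along the circle \<open>h\<close> is the affine image of the tangent of a half angle. The tangent is standard
  Cauchy distributed, and the affine map to arc length on the line moves the centre to \<open>t0\<close> and the
  scale to \<open>\<bar>\<kappa>\<bar>\<close>. The pole is a null set.
\<close>

lemma limit_measure_moebius_line:
  fixes a b c d z v :: complex and t0 \<kappa> :: real
  assumes c: "c \<noteq> 0" "norm (d / c) = 1"
    and x0: "(a / c + b / d) / 2 = z + of_real t0 * v"
    and \<kappa>: "- ((a / c - b / d) / (2 * \<i>)) = of_real \<kappa> * v" "\<kappa> \<noteq> 0"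
    and \<rho>: "\<rho> \<in> borel_measurable sphere_borel"
      "\<And>t. \<rho> (Some (z + of_real t * v)) = cauchy_density t0 \<bar>\<kappa>\<bar> t"
  shows "limit_measure (sphere_moebius a b c d) = density (line_arc_length z v) (\<lambda>y. ennreal (\<rho> y))"
proof -
  define \<theta>1 where "\<theta>1 = Arg (d / c)"
  have \<theta>1: "d / c = cis \<theta>1" "- pi < \<theta>1" "\<theta>1 \<le> pi"
    using Arg_bounded[of "d / c"] c(2) rcis_cmod_Arg[of "d / c"] by (auto simp: \<theta>1_def rcis_def)
  define L :: "real \<Rightarrow> complex option" where "L t = Some (z + of_real t * v)" for t
  have L[measurable]: "L \<in> measurable borel sphere_borel"
    using measurable_into_sphere[where M = borel and S = "\<lambda>_. False" and g = "\<lambda>t::real. z + of_real t * v"]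
    by (simp add: L_def[abs_def])
  note \<rho>(1)[measurable]
  have cis[measurable]: "cis \<in> borel_measurable borel"
    by (intro borel_measurable_continuous_onI continuous_intros)
  note measurable_moebius[of a b c d, measurable]
  have hc: "(\<lambda>\<theta>. sphere_moebius a b c d (Some (cis \<theta>))) \<in> measurable borel sphere_borel"
    by measurable
  have "limit_measure (sphere_moebius a b c d)
      = distr uniform_angle sphere_borel (\<lambda>\<theta>. sphere_moebius a b c d (Some (cis \<theta>)))"
    by (rule limit_measure_eq_distr) (rule measurable_moebius)
  also have "\<dots> = distr uniform_angle sphere_borel (\<lambda>\<theta>. L (t0 + \<kappa> * tan ((\<theta> - \<theta>1) / 2)))"
  proof (rule distr_cong_AE)
    show "AE \<theta> in uniform_angle. sphere_moebius a b c d (Some (cis \<theta>)) = L (t0 + \<kappa> * tan ((\<theta> - \<theta>1) / 2))"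
      using AE_uniform_angle[OF AE_cos_half_nonzero[of \<theta>1]]
    proof eventually_elim
      case (elim \<theta>)
      have "(a / c + b / d) / 2 - (a / c - b / d) / (2 * \<i>) * y = z + (of_real t0 + of_real \<kappa> * y) * v" for y
      proof -
        have "(a / c + b / d) / 2 - (a / c - b / d) / (2 * \<i>) * y
          = (a / c + b / d) / 2 + - ((a / c - b / d) / (2 * \<i>)) * y" by simp
        then show ?thesis unfolding x0 \<kappa>(1) by (simp add: algebra_simps)
      qed
      then show ?case
        using elim unfolding moebius_circle_tan[OF c(1) \<theta>1(1)] by (simp add: L_def)
    qed
    show "(\<lambda>\<theta>. sphere_moebius a b c d (Some (cis \<theta>))) \<in> measurable uniform_angle sphere_borel"
      "(\<lambda>\<theta>. L (t0 + \<kappa> * tan ((\<theta> - \<theta>1) / 2))) \<in> measurable uniform_angle sphere_borel"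
      by measurable
  qed simp_all
  also have "\<dots> = distr (distr (distr uniform_angle borel (\<lambda>\<theta>. tan ((\<theta> - \<theta>1) / 2))) borel (\<lambda>t. t0 + \<kappa> * t)) sphere_borel L"
    by (subst distr_distr, simp, simp, subst distr_distr) (auto simp: o_def)
  also have "\<dots> = distr (density lborel (\<lambda>t. ennreal (\<rho> (L t)))) sphere_borel L"
    unfolding tan_half_angle_distr[OF \<theta>1(2,3)] affine_standard_cauchy[OF \<kappa>(2)] by (simp add: L_def \<rho>(2))
  also have "\<dots> = density (line_arc_length z v) (\<lambda>y. ennreal (\<rho> y))"
    unfolding line_arc_length_def L_def[symmetric] by (rule density_distr[symmetric]) auto
  finally show ?thesis .
qed

text \<open>
  Only the values of \<open>\<rho>\<close> on the line are prescribed, which covers both the radial extension of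
  the Cauchy density and the one that depends on the real part alone. Continuity on the line is
  inherited from the radial one, which is continuous on the whole sphere.
\<close>

lemma moebius_line_concentration:
  fixes a b c d z v :: complex and t0 \<kappa> :: real
  assumes v: "norm v = 1" and c: "c \<noteq> 0" "norm (d / c) = 1"
    and x0: "(a / c + b / d) / 2 = z + of_real t0 * v"
    and \<kappa>: "- ((a / c - b / d) / (2 * \<i>)) = of_real \<kappa> * v" "\<kappa> \<noteq> 0"
    and \<rho>: "\<rho> \<in> borel_measurable sphere_borel" "\<rho> None = 0"
      "\<And>t. \<rho> (Some (z + of_real t * v)) = cauchy_density t0 \<bar>\<kappa>\<bar> t"
  shows "is_concentration (sphere_moebius a b c d) z v \<rho>"
  unfolding is_concentration_def
proof (intro conjI)
  show "\<rho> \<in> borel_measurable sphere_borel" by fact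
  show "\<forall>y\<in>sphere_line z v. 0 \<le> \<rho> y"
    using \<rho>(2,3) \<kappa>(2) by (auto simp: sphere_line_def cauchy_density_nonneg)
  show "limit_measure (sphere_moebius a b c d) = density (line_arc_length z v) (\<lambda>y. ennreal (\<rho> y))"
    by (rule limit_measure_moebius_line[OF c x0 \<kappa> \<rho>(1,3)])
  define x where "x = z + of_real t0 * v"
  define r where "r w = cauchy_density 0 \<bar>\<kappa>\<bar> (norm (w - x))" for w
  have "continuous_on UNIV r"
    unfolding r_def cauchy_density_def using \<kappa>(2)
    by (intro continuous_intros) (simp add: add_nonneg_eq_0_iff)
  moreover have "(r \<longlongrightarrow> 0) at_infinity"
  proof -
    have "filterlim (\<lambda>w. norm (w - x)) at_top at_infinity"
      using filterlim_at_infinity_imp_norm_at_top[OF tendsto_add_filterlim_at_infinity'[OF filterlim_ident tendsto_const[of "- x"]]]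
      by simp
    moreover have "(cauchy_density 0 \<bar>\<kappa>\<bar> \<longlongrightarrow> 0) at_top"
    proof -
      have "filterlim (\<lambda>s::real. \<bar>\<kappa>\<bar>\<^sup>2 + (s - 0)\<^sup>2) at_top at_top"
        by (intro filterlim_tendsto_add_at_top[OF tendsto_const] filterlim_pow_at_top) (auto simp: filterlim_ident)
      then have "filterlim (\<lambda>s::real. pi * ((s - 0)\<^sup>2 + \<bar>\<kappa>\<bar>\<^sup>2)) at_top at_top"
        by (intro filterlim_tendsto_pos_mult_at_top[OF tendsto_const]) (auto simp: add.commute)
      from tendsto_divide_0[OF tendsto_const filterlim_at_top_imp_at_infinity[OF this]]
      show ?thesis unfolding cauchy_density_def[abs_def] .
    qed
    ultimately show ?thesis unfolding r_def by (rule filterlim_compose[rotated])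
  qed
  ultimately have "continuous_map riemann_sphere euclideanreal (\<lambda>y. case y of None \<Rightarrow> 0 | Some w \<Rightarrow> r w)"
    by (rule continuous_map_sphere_vanishing)
  then have "continuous_map (subtopology riemann_sphere (sphere_line z v)) euclideanreal
      (\<lambda>y. case y of None \<Rightarrow> 0 | Some w \<Rightarrow> r w)"
    by (rule continuous_map_from_subtopology)
  then show "continuous_map (subtopology riemann_sphere (sphere_line z v)) euclideanreal \<rho>"
  proof (rule continuous_map_eq)
    fix y assume "y \<in> topspace (subtopology riemann_sphere (sphere_line z v))"
    then consider "y = None" | t where "y = Some (z + of_real t * v)" by (auto simp: sphere_line_def)
    then show "(case y of None \<Rightarrow> 0 | Some w \<Rightarrow> r w) = \<rho> y"
    proof cases
      case (2 t)
      have "z + of_real t * v - x = of_real (t - t0) * v" by (simp add: x_def algebra_simps)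
      then have "norm (z + of_real t * v - x) = \<bar>t - t0\<bar>" using v by (simp add: norm_mult del: of_real_diff)
      then show ?thesis using 2 by (simp add: \<rho>(3) r_def cauchy_density_def)
    qed (simp add: \<rho>(2))
  qed
qed

lemma moebius_line_highest_concentration:
  fixes a b c d z v :: complex and t0 \<kappa> :: real
  assumes v: "norm v = 1" and c: "c \<noteq> 0" "norm (d / c) = 1"
    and x0: "(a / c + b / d) / 2 = z + of_real t0 * v"
    and \<kappa>: "- ((a / c - b / d) / (2 * \<i>)) = of_real \<kappa> * v" "\<kappa> \<noteq> 0"
  shows "is_highest_concentration (sphere_moebius a b c d) z v (Some ((a / c + b / d) / 2))"
proof -
  define x where "x = z + of_real t0 * v"
  define \<rho> where "\<rho> = (\<lambda>y. case y of None \<Rightarrow> 0 | Some w \<Rightarrow> cauchy_density 0 \<bar>\<kappa>\<bar> (norm (w - x)))"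
  have \<rho>_Some: "\<rho> (Some (z + of_real t * v)) = cauchy_density t0 \<bar>\<kappa>\<bar> t" for t
  proof -
    have "z + of_real t * v - x = of_real (t - t0) * v" by (simp add: x_def algebra_simps)
    then have "norm (z + of_real t * v - x) = \<bar>t - t0\<bar>" using v by (simp add: norm_mult del: of_real_diff)
    then show ?thesis by (simp add: \<rho>_def cauchy_density_def)
  qed
  have meas: "\<rho> \<in> borel_measurable sphere_borel"
    unfolding \<rho>_def by (rule measurable_from_sphere) measurable
  have conc: "is_concentration (sphere_moebius a b c d) z v \<rho>"
    by (rule moebius_line_concentration[OF v c x0 \<kappa> meas _ \<rho>_Some]) (simp add: \<rho>_def)
  have peak: "\<rho> (Some x) = \<bar>\<kappa>\<bar> / (pi * \<kappa>\<^sup>2)"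
    using \<rho>_Some[of t0] by (simp add: x_def cauchy_density_def)
  have "\<rho> y < \<rho> (Some x)" if "y \<in> sphere_line z v" "y \<noteq> Some x" for y
  proof -
    from that consider "y = None" | t where "y = Some (z + of_real t * v)" by (auto simp: sphere_line_def)
    then show ?thesis
    proof cases
      case 1
      then show ?thesis unfolding peak using \<kappa>(2) by (simp add: \<rho>_def)
    next
      case (2 t)
      then have "t \<noteq> t0" using that(2) by (auto simp: x_def)
      then have "(t - t0)\<^sup>2 > 0" by simp
      have "cauchy_density t0 \<bar>\<kappa>\<bar> t < \<bar>\<kappa>\<bar> / (pi * \<kappa>\<^sup>2)"
        unfolding cauchy_density_def using \<kappa>(2) \<open>(t - t0)\<^sup>2 > 0\<close>
        by (intro divide_strict_left_mono) (auto intro!: mult_pos_pos add_pos_pos)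
      then show ?thesis unfolding peak 2 \<rho>_Some .
    qed
  qed
  moreover have "Some x \<in> sphere_line z v" by (auto simp: x_def sphere_line_def)
  ultimately show ?thesis
    unfolding is_highest_concentration_def x0 x_def[symmetric] using conc by blast
qed


section \<open>Equidistribution of an irrational rotation\<close>

definition hits :: "(nat \<Rightarrow> bool) \<Rightarrow> nat \<Rightarrow> nat" where
  "hits S n = card {i \<in> {0..n}. S i}"

lemma hits_le_add:
  assumes "\<And>i. i \<ge> N \<Longrightarrow> S i \<Longrightarrow> T i"
  shows "hits S n \<le> hits T n + N"
proof -
  have "hits S n \<le> card ({i \<in> {0..n}. T i} \<union> {..<N})"
    unfolding hits_def using assms by (intro card_mono) (auto simp: not_less)
  also have "\<dots> \<le> hits T n + N"
    unfolding hits_def by (rule order_trans[OF card_Un_le]) simp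
  finally show ?thesis .
qed

lemma hits_shift_forward:
  assumes "\<And>i. S i \<Longrightarrow> T (i + k)"
  shows "hits S n \<le> hits T n + k"
proof -
  have "hits S n = card ((\<lambda>i. i + k) ` {i \<in> {0..n}. S i})"
    unfolding hits_def by (rule card_image[symmetric]) (auto simp: inj_on_def)
  also have "\<dots> \<le> card ({i \<in> {0..n}. T i} \<union> {n<..n + k})"
    using assms by (intro card_mono) auto
  also have "\<dots> \<le> hits T n + k"
    unfolding hits_def by (rule order_trans[OF card_Un_le]) simp
  finally show ?thesis .
qed

lemma hits_shift_backward:
  assumes "\<And>i. S (i + k) \<Longrightarrow> T i"
  shows "hits S n \<le> hits T n + k"
proof -
  have "{i \<in> {0..n}. S i} \<subseteq> (\<lambda>i. i + k) ` {i \<in> {0..n}. T i} \<union> {..<k}"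
  proof
    fix i assume i: "i \<in> {i \<in> {0..n}. S i}"
    show "i \<in> (\<lambda>i. i + k) ` {i \<in> {0..n}. T i} \<union> {..<k}"
    proof (cases "i < k")
      case False
      then have "i = (i - k) + k" by simp
      then show ?thesis using i assms[of "i - k"] by auto
    qed simp
  qed
  then have "hits S n \<le> card ((\<lambda>i. i + k) ` {i \<in> {0..n}. T i} \<union> {..<k})"
    unfolding hits_def by (intro card_mono) auto
  also have "\<dots> \<le> card ((\<lambda>i. i + k) ` {i \<in> {0..n}. T i}) + k"
    by (rule order_trans[OF card_Un_le]) simp
  also have "\<dots> \<le> hits T n + k"
    unfolding hits_def by (simp add: card_image_le)
  finally show ?thesis .
qed

lemma hits_sum_le:
  assumes "finite I" "\<And>i. S i \<Longrightarrow> b i \<in> I"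
  shows "hits S n \<le> (\<Sum>j\<in>I. hits (\<lambda>i. b i = j) n)"
proof -
  have "hits S n \<le> card (\<Union>j\<in>I. {i \<in> {0..n}. b i = j})"
    unfolding hits_def using assms by (intro card_mono) auto
  also have "\<dots> \<le> (\<Sum>j\<in>I. hits (\<lambda>i. b i = j) n)"
    unfolding hits_def by (rule card_UN_le[OF assms(1)])
  finally show ?thesis .
qed

lemma sum_hits_le:
  assumes "finite I"
  shows "(\<Sum>j\<in>I. hits (\<lambda>i. b i = j) n) \<le> Suc n"
proof -
  have "(\<Sum>j\<in>I. hits (\<lambda>i. b i = j) n) = card (\<Union>j\<in>I. {i \<in> {0..n}. b i = j})"
    unfolding hits_def using assms by (subst card_UN_disjoint) auto
  also have "\<dots> \<le> card {0..n}" by (intro card_mono) auto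
  finally show ?thesis by simp
qed

text \<open>The inclusions may fail for finitely many indices, since these do not affect a frequency.\<close>

lemma frequency_sandwich:
  assumes "\<And>e::real. e > 0 \<Longrightarrow> \<exists>S1 S2 l1 l2. (\<forall>\<^sub>F i in sequentially. (S1 i \<longrightarrow> S i) \<and> (S i \<longrightarrow> S2 i)) \<and>
      (\<lambda>n. real (hits S1 n) / real n) \<longlonglongrightarrow> l1 \<and> (\<lambda>n. real (hits S2 n) / real n) \<longlonglongrightarrow> l2 \<and>
      l - e \<le> l1 \<and> l2 \<le> l + e"
  shows "(\<lambda>n. real (hits S n) / real n) \<longlonglongrightarrow> l"
proof (rule LIMSEQ_I)
  fix r :: real assume "r > 0"
  define e where "e = r / 4"
  have e: "e > 0" using \<open>r > 0\<close> by (simp add: e_def)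
  obtain S1 S2 l1 l2 where ev: "\<forall>\<^sub>F i in sequentially. (S1 i \<longrightarrow> S i) \<and> (S i \<longrightarrow> S2 i)"
    and l1: "(\<lambda>n. real (hits S1 n) / real n) \<longlonglongrightarrow> l1" "l - e \<le> l1"
    and l2: "(\<lambda>n. real (hits S2 n) / real n) \<longlonglongrightarrow> l2" "l2 \<le> l + e"
    using assms[OF e] by blast
  obtain N where N: "\<And>i. i \<ge> N \<Longrightarrow> (S1 i \<longrightarrow> S i) \<and> (S i \<longrightarrow> S2 i)"
    using ev by (auto simp: eventually_sequentially)
  have S1: "hits S1 n \<le> hits S n + N" and S2: "hits S n \<le> hits S2 n + N" for n
    by (rule hits_le_add, use N in blast)+
  have N0: "(\<lambda>n. real N / real n) \<longlonglongrightarrow> 0" by (rule lim_const_over_n)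
  have "l1 - e < l1" "l2 < l2 + e" using e by auto
  from order_tendstoD(1)[OF l1(1) this(1)] order_tendstoD(2)[OF l2(1) this(2)] order_tendstoD(2)[OF N0 e]
  have "\<forall>\<^sub>F n in sequentially. norm (real (hits S n) / real n - l) < r"
  proof eventually_elim
    case (elim n)
    have "real (hits S1 n) / real n \<le> real (hits S n) / real n + real N / real n"
      "real (hits S n) / real n \<le> real (hits S2 n) / real n + real N / real n"
      unfolding add_divide_distrib[symmetric] of_nat_add[symmetric]
      by (intro divide_right_mono of_nat_mono S1 S2 of_nat_0_le_iff)+
    then show ?case using elim l1(2) l2(2) e by (simp add: e_def abs_less_iff)
  qed
  then show "\<exists>no. \<forall>n\<ge>no. norm (real (hits S n) / real n - l) < r"
    by (simp add: eventually_sequentially)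
qed

lemma frac_add_small:
  assumes "frac x + frac y < 1"
  shows "frac (x + y) = frac x + frac y"
  using assms by (simp add: frac_add)

text \<open>
  If \<open>k\<close> steps rotate by a small \<open>\<eta>\<close>, then they carry each cell \<open>[j \<eta>, (j + 1) \<eta>)\<close> onto the next
  one. So all cells are visited equally often up to a bounded error, and there are about
  \<open>1 / \<eta>\<close> of them.
\<close>

lemma rotation_hits_upper_bound:
  fixes \<tau> \<omega> :: real and k :: nat
  defines "\<eta> \<equiv> frac (real k * \<omega>)" and "x \<equiv> \<lambda>i::nat. frac (\<tau> + real i * \<omega>)"
  assumes \<eta>: "\<eta> > 0"
  defines "M \<equiv> nat \<lfloor>1 / \<eta>\<rfloor>"
  assumes AB: "0 \<le> a" "a \<le> b"
  shows "real (hits (\<lambda>i. a \<le> x i \<and> x i \<le> b) n)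
           \<le> ((b - a) / \<eta> + 2) * (real (Suc n) / real M + 2 * real M * real k)"
proof -
  have x: "0 \<le> x i" "x i < 1" for i by (simp_all add: x_def frac_lt_1)
  have "\<eta> < 1" by (simp add: \<eta>_def frac_lt_1)
  then have M1: "M \<ge> 1" using \<eta> by (simp add: M_def le_nat_iff le_floor_iff)
  have M: "real M * \<eta> \<le> 1"
  proof -
    have "real M \<le> 1 / \<eta>" using \<eta> by (simp add: M_def)
    then show ?thesis using \<eta> by (simp add: field_simps)
  qed
  define cell where "cell i = nat \<lfloor>x i / \<eta>\<rfloor>" for i
  have cell: "cell i = j \<longleftrightarrow> real j * \<eta> \<le> x i \<and> x i < (real j + 1) * \<eta>" for i j
  proof -
    have "cell i = j \<longleftrightarrow> \<lfloor>x i / \<eta>\<rfloor> = int j" using x[of i] \<eta> by (auto simp: cell_def)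
    also have "\<dots> \<longleftrightarrow> real j \<le> x i / \<eta> \<and> x i / \<eta> < real j + 1" by (simp add: floor_eq_iff)
    finally show ?thesis using \<eta> by (simp add: field_simps)
  qed
  have cell_M: "cell i \<le> M" for i
    unfolding cell_def M_def using x[of i] \<eta> by (intro nat_mono floor_mono divide_right_mono) auto
  define c where "c j = hits (\<lambda>i. cell i = j) n" for j
  have x_add: "x (i + k) = x i + \<eta>" if "x i + \<eta> < 1" for i
    using frac_add_small[of "\<tau> + real i * \<omega>" "real k * \<omega>"] that by (simp add: x_def \<eta>_def algebra_simps)
  have x_sub: "x (i + k) = x i + \<eta>" if "\<eta> \<le> x (i + k)" for i
  proof (rule x_add, rule ccontr)
    assume "\<not> x i + \<eta> < 1"
    then have "x (i + k) = x i + \<eta> - 1"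
      using frac_add[of "\<tau> + real i * \<omega>" "real k * \<omega>"] by (simp add: x_def \<eta>_def algebra_simps)
    then show False using that x[of i] by simp
  qed
  \<comment> \<open>The cell after the last full one is cut off at 1, so a step upwards is safe only below it.\<close>
  have up: "c j \<le> c (Suc j) + k" if "Suc (Suc j) \<le> M" for j
    unfolding c_def
  proof (rule hits_shift_forward)
    fix i assume i: "cell i = j"
    have "real (Suc (Suc j)) * \<eta> \<le> real M * \<eta>" using that \<eta> by (intro mult_right_mono) auto
    then have "x i + \<eta> < 1" using i M by (simp add: cell algebra_simps)
    from x_add[OF this] show "cell (i + k) = Suc j" using i by (simp add: cell algebra_simps)
  qed
  have down: "c (Suc j) \<le> c j + k" for j
    unfolding c_def
  proof (rule hits_shift_backward)
    fix i assume i: "cell (i + k) = Suc j"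
    then have "(real j + 1) * \<eta> \<le> x (i + k)" by (simp add: cell add.commute)
    moreover have "\<eta> \<le> (real j + 1) * \<eta>" using \<eta> by (simp add: algebra_simps)
    ultimately have "x (i + k) = x i + \<eta>" by (intro x_sub) linarith
    then show "cell i = j" using i by (simp add: cell algebra_simps)
  qed
  have c0_le: "c 0 \<le> c j + j * k" if "j < M" for j
    using that
  proof (induction j)
    case (Suc j)
    then show ?case using up[of j] by simp
  qed simp
  have c_le: "c j \<le> c 0 + j * k" for j
  proof (induction j)
    case (Suc j)
    then show ?case using down[of j] by simp
  qed simp
  have "M * c 0 = (\<Sum>j<M. c 0)" by simp
  also have "\<dots> \<le> (\<Sum>j<M. c j + M * k)"
    by (intro sum_mono order_trans[OF c0_le]) auto
  also have "\<dots> = (\<Sum>j<M. c j) + M * (M * k)" by (simp add: sum.distrib)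
  also have "\<dots> \<le> Suc n + M * (M * k)"
    unfolding c_def by (intro add_right_mono sum_hits_le) simp
  finally have "real (M * c 0) \<le> real (Suc n + M * (M * k))" by (rule of_nat_mono)
  then have c0: "real (c 0) \<le> real (Suc n) / real M + real M * real k"
    using M1 by (simp add: field_simps)
  have c: "real (c j) \<le> real (Suc n) / real M + 2 * real M * real k" if "j \<le> M" for j
  proof -
    have "real (c j) \<le> real (c 0 + j * k)" by (rule of_nat_mono[OF c_le])
    also have "\<dots> \<le> real (c 0) + real M * real k" using that by (simp add: mult_right_mono)
    finally show ?thesis using c0 by simp
  qed
  \<comment> \<open>The indices of the cells that meet \<open>[a, b]\<close>.\<close>
  define I where "I = {nat \<lfloor>a / \<eta>\<rfloor>..nat \<lfloor>b / \<eta>\<rfloor>} \<inter> {..M}"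
  have "hits (\<lambda>i. a \<le> x i \<and> x i \<le> b) n \<le> (\<Sum>j\<in>I. c j)"
    unfolding c_def
  proof (rule hits_sum_le)
    fix i assume "a \<le> x i \<and> x i \<le> b"
    then show "cell i \<in> I" using cell_M[of i] \<eta> unfolding I_def cell_def
      by (auto intro!: nat_mono floor_mono divide_right_mono)
  qed (simp add: I_def)
  then have "real (hits (\<lambda>i. a \<le> x i \<and> x i \<le> b) n) \<le> real (\<Sum>j\<in>I. c j)"
    by (rule of_nat_mono)
  also have "\<dots> = (\<Sum>j\<in>I. real (c j))" by simp
  also have "\<dots> \<le> real (card I) * (real (Suc n) / real M + 2 * real M * real k)"
    by (rule sum_bounded_above) (use c in \<open>auto simp: I_def\<close>)
  also have "\<dots> \<le> ((b - a) / \<eta> + 2) * (real (Suc n) / real M + 2 * real M * real k)"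
  proof (rule mult_right_mono)
    have "card I \<le> card {nat \<lfloor>a / \<eta>\<rfloor>..nat \<lfloor>b / \<eta>\<rfloor>}" unfolding I_def by (intro card_mono) auto
    then have "real (card I) \<le> real (Suc (nat \<lfloor>b / \<eta>\<rfloor>) - nat \<lfloor>a / \<eta>\<rfloor>)" by simp
    also have "\<dots> = real_of_int \<lfloor>b / \<eta>\<rfloor> + 1 - real_of_int \<lfloor>a / \<eta>\<rfloor>"
    proof -
      have "0 \<le> \<lfloor>a / \<eta>\<rfloor>" "\<lfloor>a / \<eta>\<rfloor> \<le> \<lfloor>b / \<eta>\<rfloor>"
        using AB \<eta> by (auto intro!: floor_mono divide_right_mono)
      moreover from this have "0 \<le> \<lfloor>b / \<eta>\<rfloor>" by linarith
      ultimately show ?thesis by (simp add: of_nat_diff nat_mono le_SucI del: zero_le_floor)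
    qed
    also have "\<dots> \<le> b / \<eta> + 1 - (a / \<eta> - 1)"
      using of_int_floor_le[of "b / \<eta>"] real_of_int_floor_gt_diff_one[of "a / \<eta>"] by linarith
    finally show "real (card I) \<le> (b - a) / \<eta> + 2" by (simp add: diff_divide_distrib)
  qed simp
  finally show ?thesis .
qed

text \<open>Letting \<open>\<eta>\<close> tend to 0 in the previous bound removes the boundary cells; Kronecker's theorem
  supplies a number of steps with arbitrarily small \<open>\<eta> > 0\<close>.\<close>

lemma rotation_frequency_upper:
  fixes \<tau> \<omega> :: real
  assumes "\<omega> \<notin> \<rat>" and ab: "0 \<le> a" "a \<le> b" "b \<le> 1" and "e > 0"
  shows "\<forall>\<^sub>F n in sequentially.
    real (hits (\<lambda>i. a \<le> frac (\<tau> + real i * \<omega>) \<and> frac (\<tau> + real i * \<omega>) \<le> b) n) / real n < b - a + e"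
proof -
  \<comment> \<open>This makes \<open>(b - a) + 2 \<eta>\<close> less than \<open>(b - a + e) (1 - \<eta>)\<close> below.\<close>
  define e' where "e' = min 1 (e / (6 + e))"
  have e': "e' > 0" "e' \<le> 1" "e' \<le> e / (6 + e)" using \<open>e > 0\<close> by (auto simp: e'_def)
  obtain k where k: "\<bar>frac (real k * \<omega>) - e' / 2\<bar> < e' / 2"
    using Kronecker_approx_1_explicit[OF assms(1), of "e' / 2" "e' / 2"] e' by auto
  define \<eta> where "\<eta> = frac (real k * \<omega>)"
  have \<eta>: "0 < \<eta>" "\<eta> < e'" using k by (auto simp: \<eta>_def abs_less_iff field_simps)
  then have \<eta>1: "\<eta> < 1" using e' by simp
  have \<eta>e: "\<eta> * (6 + e) < e"
  proof -
    have "\<eta> < e / (6 + e)" using \<eta> e' by linarith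
    then show ?thesis using \<open>e > 0\<close> by (simp add: pos_less_divide_eq)
  qed
  define M where "M = nat \<lfloor>1 / \<eta>\<rfloor>"
  have M1: "M \<ge> 1" using \<eta> \<eta>1 by (simp add: M_def le_nat_iff le_floor_iff)
  have "real M = real_of_int \<lfloor>1 / \<eta>\<rfloor>" using \<eta> by (simp add: M_def)
  then have "1 / \<eta> - 1 < real M" using real_of_int_floor_gt_diff_one[of "1 / \<eta>"] by simp
  then have M: "(1 - \<eta>) < real M * \<eta>" using \<eta> by (simp add: field_simps)
  define C where "C = (b - a) / \<eta> + 2"
  have C: "C / real M < b - a + e"
  proof -
    have "C * \<eta> = b - a + 2 * \<eta>" using \<eta> by (simp add: C_def field_simps)
    also have "\<dots> < (b - a + e) * (1 - \<eta>)"
    proof -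
      have "\<eta> * (b - a) \<le> \<eta> * 1" using \<eta> ab by (intro mult_left_mono) auto
      then show ?thesis using \<eta>e \<eta> by (simp add: algebra_simps)
    qed
    also have "\<dots> \<le> (b - a + e) * (real M * \<eta>)"
      using M ab \<open>e > 0\<close> by (intro mult_left_mono) auto
    finally have "C * \<eta> < ((b - a + e) * real M) * \<eta>" by (simp add: mult.assoc)
    then have "C < (b - a + e) * real M" using \<eta> by simp
    then show ?thesis using M1 by (simp add: pos_divide_less_eq)
  qed
  have "(\<lambda>n. C * ((1 + 1 / real n) / real M + 2 * real M * real k / real n)) \<longlonglongrightarrow> C * ((1 + 0) / real M + 0)"
    using M1 by (intro tendsto_intros lim_const_over_n) auto
  then have "(\<lambda>n. C * ((1 + 1 / real n) / real M + 2 * real M * real k / real n)) \<longlonglongrightarrow> C / real M" by simp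
  from order_tendstoD(2)[OF this C] eventually_gt_at_top[of 0] show ?thesis
  proof eventually_elim
    case (elim n)
    let ?h = "hits (\<lambda>i. a \<le> frac (\<tau> + real i * \<omega>) \<and> frac (\<tau> + real i * \<omega>) \<le> b) n"
    have "real ?h \<le> C * (real (Suc n) / real M + 2 * real M * real k)"
      unfolding C_def \<eta>_def M_def
      by (rule rotation_hits_upper_bound) (use \<eta> ab in \<open>simp_all add: \<eta>_def\<close>)
    then have "real ?h / real n \<le> C * (real (Suc n) / real M + 2 * real M * real k) / real n"
      by (rule divide_right_mono) simp
    also have "\<dots> = C * ((1 + 1 / real n) / real M + 2 * real M * real k / real n)"
    proof -
      have "real (Suc n) / real M / real n = (1 + 1 / real n) / real M"
        using elim(2) M1 by (simp add: field_simps)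
      then show ?thesis unfolding times_divide_eq_right[symmetric] add_divide_distrib[of _ _ "real n"]
        by simp
    qed
    finally show ?case using elim(1) by linarith
  qed
qed

text \<open>The lower bound is the upper bound for the two complementary intervals.\<close>

theorem irrational_rotation_equidistributed:
  fixes \<tau> \<omega> :: real
  assumes "\<omega> \<notin> \<rat>" and ab: "0 \<le> a" "a \<le> b" "b \<le> 1"
  shows "(\<lambda>n. real (hits (\<lambda>i. a \<le> frac (\<tau> + real i * \<omega>) \<and> frac (\<tau> + real i * \<omega>) \<le> b) n) / real n)
           \<longlonglongrightarrow> b - a"
proof (rule LIMSEQ_I)
  fix r :: real assume "r > 0"
  define H where "H u v = hits (\<lambda>i. u \<le> frac (\<tau> + real i * \<omega>) \<and> frac (\<tau> + real i * \<omega>) \<le> v)" for u v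
  have up: "\<forall>\<^sub>F n in sequentially. real (H u v n) / real n < v - u + r / 2"
    if "0 \<le> u" "u \<le> v" "v \<le> 1" for u v
    unfolding H_def using rotation_frequency_upper[OF assms(1) that] \<open>r > 0\<close> by simp
  have "\<forall>\<^sub>F n in sequentially. real (H 0 a n) / real n < a - 0 + r / 2"
    "\<forall>\<^sub>F n in sequentially. real (H b 1 n) / real n < 1 - b + r / 2"
    by (rule up; use ab in simp)+
  with up[OF ab] eventually_gt_at_top[of 0]
  have "\<forall>\<^sub>F n in sequentially. norm (real (H a b n) / real n - (b - a)) < r"
  proof eventually_elim
    case (elim n)
    have "{0..n} \<subseteq> {i \<in> {0..n}. a \<le> frac (\<tau> + real i * \<omega>) \<and> frac (\<tau> + real i * \<omega>) \<le> b} \<union>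
        ({i \<in> {0..n}. 0 \<le> frac (\<tau> + real i * \<omega>) \<and> frac (\<tau> + real i * \<omega>) \<le> a} \<union>
         {i \<in> {0..n}. b \<le> frac (\<tau> + real i * \<omega>) \<and> frac (\<tau> + real i * \<omega>) \<le> 1})" (is "_ \<subseteq> ?A \<union> (?B \<union> ?C)")
      by (auto simp: less_imp_le frac_lt_1)
    then have "card {0..n} \<le> card (?A \<union> (?B \<union> ?C))" by (intro card_mono) auto
    also have "\<dots> \<le> card ?A + (card ?B + card ?C)"
      using card_Un_le[of ?A "?B \<union> ?C"] card_Un_le[of ?B ?C] by linarith
    finally have "real n \<le> real (H a b n) + (real (H 0 a n) + real (H b 1 n))"
      by (simp add: H_def hits_def)
    then have "1 \<le> (real (H a b n) + (real (H 0 a n) + real (H b 1 n))) / real n"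
      using elim by simp
    then have "1 \<le> real (H a b n) / real n + (real (H 0 a n) / real n + real (H b 1 n) / real n)"
      by (simp add: add_divide_distrib)
    then show ?case using elim \<open>r > 0\<close> by (simp add: abs_less_iff)
  qed
  then show "\<exists>no. \<forall>n\<ge>no. norm (real (hits (\<lambda>i. a \<le> frac (\<tau> + real i * \<omega>) \<and> frac (\<tau> + real i * \<omega>) \<le> b) n) / real n - (b - a)) < r"
    by (simp add: eventually_sequentially H_def)
qed


section \<open>Limiting frequencies\<close>

lemma cos_eq_0_iff_frac: "cos (pi * (y - 1 / 2)) = 0 \<longleftrightarrow> frac y = (0::real)"
proof -
  have "cos (pi * (y - 1 / 2)) = sin (pi * y)" by (simp add: right_diff_distrib cos_diff)
  then show ?thesis
    by (auto simp: sin_zero_iff_int2 frac_eq_0_iff Ints_def mult.commute[of pi])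
qed

text \<open>The tangent is increasing on the period that corresponds to the fractional part, and the pole
  has fractional part 0, which is below \<open>arctan u / pi + 1 / 2\<close>. So the equivalence needs no
  exceptional point.\<close>

lemma tan_between_iff_frac:
  fixes y u v :: real
  defines "\<psi> \<equiv> pi * (y - 1 / 2)"
  shows "cos \<psi> \<noteq> 0 \<and> u \<le> tan \<psi> \<and> tan \<psi> \<le> v
    \<longleftrightarrow> arctan u / pi + 1 / 2 \<le> frac y \<and> frac y \<le> arctan v / pi + 1 / 2"
proof (cases "frac y = 0")
  case True
  have "arctan u / pi + 1 / 2 > 0" using arctan_lbound[of u] by (simp add: field_simps)
  then show ?thesis using True cos_eq_0_iff_frac[of y]
    by (simp add: \<psi>_def del: frac_eq_0_iff)
next
  case False
  define \<phi> where "\<phi> = pi * (frac y - 1 / 2)"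
  have "frac y > 0" using False frac_ge_0[of y] by linarith
  then have \<phi>: "- (pi / 2) < \<phi>" "\<phi> < pi / 2" using frac_lt_1[of y] by (simp_all add: \<phi>_def field_simps)
  have "\<psi> = \<phi> + of_int \<lfloor>y\<rfloor> * pi" by (simp add: \<phi>_def \<psi>_def frac_def algebra_simps)
  then have "tan \<psi> = tan \<phi>" by simp
  moreover have "u \<le> tan \<phi> \<longleftrightarrow> arctan u \<le> \<phi>" "tan \<phi> \<le> v \<longleftrightarrow> \<phi> \<le> arctan v"
    using arctan_le_iff[of u "tan \<phi>"] arctan_le_iff[of "tan \<phi>" v] arctan_tan[OF \<phi>] by auto
  moreover have "arctan u \<le> \<phi> \<longleftrightarrow> arctan u / pi + 1 / 2 \<le> frac y" "\<phi> \<le> arctan v \<longleftrightarrow> frac y \<le> arctan v / pi + 1 / 2"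
    by (simp_all add: \<phi>_def field_simps)
  moreover have "cos \<psi> \<noteq> 0" using False cos_eq_0_iff_frac[of y] by (simp add: \<psi>_def)
  ultimately show ?thesis by simp
qed

lemma tan_frequencies:
  fixes \<nu> t u v :: real
  assumes irr: "\<nu> / (2 * pi) \<notin> \<rat>" and uv: "u \<le> v"
  defines "\<psi> \<equiv> \<lambda>i::nat. (real (i + 1) * \<nu> - t) / 2"
  shows "(\<lambda>n. real (hits (\<lambda>i. cos (\<psi> i) \<noteq> 0 \<and> u \<le> tan (\<psi> i) \<and> tan (\<psi> i) \<le> v) n) / real n)
           \<longlonglongrightarrow> arctan v / pi - arctan u / pi"
proof -
  define \<omega> where "\<omega> = \<nu> / (2 * pi)"
  define \<tau> where "\<tau> = (\<nu> - t) / (2 * pi) + 1 / 2"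
  have \<psi>: "\<psi> i = pi * ((\<tau> + real i * \<omega>) - 1 / 2)" for i
    by (simp add: \<psi>_def \<tau>_def \<omega>_def field_simps)
  have "arctan u \<le> arctan v" using uv by (simp add: arctan_le_iff)
  then have "0 \<le> arctan u / pi + 1 / 2" "arctan u / pi + 1 / 2 \<le> arctan v / pi + 1 / 2" "arctan v / pi + 1 / 2 \<le> 1"
    using arctan_lbound[of u] arctan_ubound[of v] by (simp_all add: field_simps)
  from irrational_rotation_equidistributed[OF irr[folded \<omega>_def] this, of \<tau>]
  show ?thesis unfolding \<psi> tan_between_iff_frac by simp
qed

definition cauchy_cdf :: "real \<Rightarrow> real \<Rightarrow> real \<Rightarrow> real" where
  "cauchy_cdf x0 s x = arctan ((x - x0) / s) / pi"

lemma cauchy_cdf_mono: "s > 0 \<Longrightarrow> x \<le> y \<Longrightarrow> cauchy_cdf x0 s x \<le> cauchy_cdf x0 s y"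
  by (simp add: cauchy_cdf_def divide_right_mono arctan_le_iff)

lemma DERIV_cauchy_cdf:
  assumes "s > 0"
  shows "(cauchy_cdf x0 s has_real_derivative cauchy_density x0 s x) (at x)"
proof -
  have "((\<lambda>x. arctan ((x - x0) / s) / pi) has_real_derivative (inverse (1 + ((x - x0) / s)\<^sup>2) * (1 / s)) / pi) (at x)"
    using assms by (auto intro!: derivative_eq_intros)
  moreover have "(inverse (1 + ((x - x0) / s)\<^sup>2) * (1 / s)) / pi = cauchy_density x0 s x"
  proof -
    have "1 + ((x - x0) / s)\<^sup>2 = ((x - x0)\<^sup>2 + s\<^sup>2) / s\<^sup>2"
      using assms by (simp add: power_divide field_simps)
    then show ?thesis using assms by (simp add: cauchy_density_def power2_eq_square)
  qed
  ultimately show ?thesis by (simp add: cauchy_cdf_def[abs_def])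
qed

definition in_interval :: "real \<Rightarrow> real \<Rightarrow> complex option \<Rightarrow> bool" where
  "in_interval u v y \<longleftrightarrow> y \<in> Some ` of_real ` {u..v}"

lemma has_limiting_frequencies_cauchyI:
  assumes "s > 0"
    and "\<And>u v. u \<le> v \<Longrightarrow>
      (\<lambda>n. real (hits (\<lambda>i. in_interval u v (g i)) n) / real n) \<longlonglongrightarrow> cauchy_cdf x0 s v - cauchy_cdf x0 s u"
  shows "has_limiting_frequencies g (cauchy_density x0 s)"
  unfolding has_limiting_frequencies_def
proof (intro allI impI)
  fix u v :: real assume "u \<le> v"
  have "(cauchy_density x0 s has_integral cauchy_cdf x0 s v - cauchy_cdf x0 s u) {u..v}"
    using \<open>u \<le> v\<close> DERIV_cauchy_cdf[OF assms(1)]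
    by (intro fundamental_theorem_of_calculus)
       (auto simp flip: has_real_derivative_iff_has_vector_derivative intro: has_field_derivative_at_within)
  then show "cauchy_density x0 s integrable_on {u..v} \<and>
      (\<lambda>n. real (card {i \<in> {0..n}. g i \<in> Some ` of_real ` {u..v}}) / real n) \<longlonglongrightarrow> integral {u..v} (cauchy_density x0 s)"
    using assms(2)[OF \<open>u \<le> v\<close>]
    by (auto simp: hits_def in_interval_def integral_unique has_integral_integrable)
qed

text \<open>For a negative scale the interval of tangents is reversed, and oddness of \<open>arctan\<close> restores
  the order.\<close>

lemma cauchy_frequencies:
  fixes \<nu> t x0 \<kappa> u v :: real
  assumes irr: "\<nu> / (2 * pi) \<notin> \<rat>" and \<kappa>: "\<kappa> \<noteq> 0" and uv: "u \<le> v"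
  defines "\<psi> \<equiv> \<lambda>i::nat. (real (i + 1) * \<nu> - t) / 2"
  assumes g: "\<And>i. g i = (if cos (\<psi> i) = 0 then None else Some (of_real (x0 + \<kappa> * tan (\<psi> i))))"
  shows "(\<lambda>n. real (hits (\<lambda>i. in_interval u v (g i)) n) / real n)
           \<longlonglongrightarrow> cauchy_cdf x0 (\<bar>\<kappa>\<bar>) v - cauchy_cdf x0 (\<bar>\<kappa>\<bar>) u"
proof -
  have Some_iff: "in_interval u v (Some (of_real y)) \<longleftrightarrow> u \<le> y \<and> y \<le> v" for y
    by (auto simp: in_interval_def inj_image_mem_iff)
  have in_iff: "in_interval u v (g i) \<longleftrightarrow> cos (\<psi> i) \<noteq> 0 \<and> u \<le> x0 + \<kappa> * tan (\<psi> i) \<and> x0 + \<kappa> * tan (\<psi> i) \<le> v" for i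
    unfolding g using Some_iff[of "x0 + \<kappa> * tan (\<psi> i)"] by (auto simp: in_interval_def)
  have tan: "(\<lambda>n. real (hits (\<lambda>i. cos (\<psi> i) \<noteq> 0 \<and> u' \<le> tan (\<psi> i) \<and> tan (\<psi> i) \<le> v') n) / real n)
      \<longlonglongrightarrow> arctan v' / pi - arctan u' / pi" if "u' \<le> v'" for u' v'
    unfolding \<psi>_def by (rule tan_frequencies[OF irr that])
  show ?thesis
  proof (cases "\<kappa> > 0")
    case True
    have "(u - x0) / \<kappa> \<le> (v - x0) / \<kappa>" using True uv by (simp add: divide_right_mono)
    note * = tan[OF this]
    have "(u - x0) / \<kappa> \<le> y \<and> y \<le> (v - x0) / \<kappa> \<longleftrightarrow> u \<le> x0 + \<kappa> * y \<and> x0 + \<kappa> * y \<le> v" for y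
      using True by (auto simp: pos_divide_le_eq pos_le_divide_eq algebra_simps)
    with * True show ?thesis unfolding in_iff by (simp add: cauchy_cdf_def)
  next
    case False
    then have neg: "\<kappa> < 0" using \<kappa> by simp
    have "(v - x0) / \<kappa> \<le> (u - x0) / \<kappa>" using neg uv by (simp add: divide_right_mono_neg)
    note * = tan[OF this]
    have "(v - x0) / \<kappa> \<le> y \<and> y \<le> (u - x0) / \<kappa> \<longleftrightarrow> u \<le> x0 + \<kappa> * y \<and> x0 + \<kappa> * y \<le> v" for y
      using neg by (auto simp: neg_divide_le_eq neg_le_divide_eq algebra_simps)
    moreover have "arctan ((u - x0) / \<kappa>) / pi - arctan ((v - x0) / \<kappa>) / pi = cauchy_cdf x0 (\<bar>\<kappa>\<bar>) v - cauchy_cdf x0 (\<bar>\<kappa>\<bar>) u"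
      using neg by (simp add: cauchy_cdf_def arctan_minus)
    ultimately show ?thesis using * unfolding in_iff by simp
  qed
qed

text \<open>A small change of the terms is absorbed by a small change of the end points, and the limiting
  frequency is continuous in the end points.\<close>

lemma frequencies_perturbation:
  fixes F :: "real \<Rightarrow> real"
  assumes F: "\<And>x y. x \<le> y \<Longrightarrow> F x \<le> F y" "\<And>x. isCont F x"
    and g: "\<And>u v. u \<le> v \<Longrightarrow> (\<lambda>n. real (hits (\<lambda>i. in_interval u v (g i)) n) / real n) \<longlonglongrightarrow> F v - F u"
    and k: "\<And>u v e. u \<le> v \<Longrightarrow> e > 0 \<Longrightarrow> \<forall>\<^sub>F i in sequentially.
      (in_interval (u + e) (v - e) (g i) \<longrightarrow> in_interval u v (k i)) \<and>
      (in_interval u v (k i) \<longrightarrow> in_interval (u - e) (v + e) (g i))"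
    and uv: "u \<le> v"
  shows "(\<lambda>n. real (hits (\<lambda>i. in_interval u v (k i)) n) / real n) \<longlonglongrightarrow> F v - F u"
proof (rule frequency_sandwich)
  fix e :: real assume "e > 0"
  have lim: "((\<lambda>t. F (v + t) - F (u - t)) \<longlongrightarrow> F v - F u) (at_right 0)"
    "((\<lambda>t. F (v - t) - F (u + t)) \<longlongrightarrow> F v - F u) (at_right 0)"
    by (auto intro!: tendsto_eq_intros isCont_tendsto_compose[OF F(2)])
  have "\<forall>\<^sub>F t in at_right 0. F (v + t) - F (u - t) < F v - F u + e"
    "\<forall>\<^sub>F t in at_right 0. F v - F u - e < F (v - t) - F (u + t)"
    using order_tendstoD(2)[OF lim(1)] order_tendstoD(1)[OF lim(2)] \<open>e > 0\<close> by auto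
  with eventually_at_right_less[of 0]
  have "\<forall>\<^sub>F t in at_right 0. 0 < t \<and> F (v + t) - F (u - t) < F v - F u + e \<and> F v - F u - e < F (v - t) - F (u + t)"
    by eventually_elim auto
  then obtain t where t: "t > 0" "F (v + t) - F (u - t) < F v - F u + e" "F v - F u - e < F (v - t) - F (u + t)"
    using eventually_happens[of _ "at_right (0::real)"] by auto
  \<comment> \<open>The shrunken interval may be empty; then monotonicity of \<open>F\<close> makes 0 large enough.\<close>
  define l1 where "l1 = (if u + t \<le> v - t then F (v - t) - F (u + t) else 0)"
  have "(\<lambda>n. real (hits (\<lambda>i. in_interval (u + t) (v - t) (g i)) n) / real n) \<longlonglongrightarrow> l1"
  proof (cases "u + t \<le> v - t")
    case True
    then show ?thesis using g[OF True] by (simp add: l1_def)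
  next
    case False
    then have "\<not> in_interval (u + t) (v - t) y" for y by (auto simp: in_interval_def)
    then show ?thesis using False by (simp add: l1_def hits_def)
  qed
  moreover have "F v - F u - e \<le> l1"
    using t F(1)[of "v - t" "u + t"] by (auto simp: l1_def)
  moreover have "(\<lambda>n. real (hits (\<lambda>i. in_interval (u - t) (v + t) (g i)) n) / real n) \<longlonglongrightarrow> F (v + t) - F (u - t)"
    using g[of "u - t" "v + t"] uv t by simp
  ultimately show "\<exists>S1 S2 l1 l2. (\<forall>\<^sub>F i in sequentially. (S1 i \<longrightarrow> in_interval u v (k i)) \<and> (in_interval u v (k i) \<longrightarrow> S2 i)) \<and>
      (\<lambda>n. real (hits S1 n) / real n) \<longlonglongrightarrow> l1 \<and> (\<lambda>n. real (hits S2 n) / real n) \<longlonglongrightarrow> l2 \<and>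
      F v - F u - e \<le> l1 \<and> l2 \<le> F v - F u + e"
    using k[OF uv t(1)] less_imp_le[OF t(2)]
    by (intro exI[of _ "\<lambda>i. in_interval (u + t) (v - t) (g i)"] exI[of _ "\<lambda>i. in_interval (u - t) (v + t) (g i)"]
        exI[of _ l1] exI[of _ "F (v + t) - F (u - t)"] conjI)
qed

text \<open>A lower bound for the homogeneous vector bounds the denominator below wherever the quotient
  is bounded, so on bounded sets asymptotic equality is uniform.\<close>

lemma sphere_quot_close:
  assumes p: "(\<lambda>n. p2 n - p1 n) \<longlonglongrightarrow> 0" and q: "(\<lambda>n. q2 n - q1 n) \<longlonglongrightarrow> 0"
    and lower: "\<forall>\<^sub>F n in sequentially. \<eta> \<le> norm (p1 n) + norm (q1 n)" and pos: "\<eta> > 0" "e > 0" "M \<ge> 0"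
  shows "\<forall>\<^sub>F n in sequentially. \<forall>y. sphere_quot (p1 n) (q1 n) = Some y \<and> norm y \<le> M \<longrightarrow>
           (\<exists>x. sphere_quot (p2 n) (q2 n) = Some x \<and> norm (x - y) < e)"
proof -
  define m where "m = \<eta> / (1 + M)"
  have m: "m > 0" using pos by (simp add: m_def)
  define r where "r = min (m / 2) (e * (m / 2) / (2 * (1 + M)))"
  have r: "r > 0" using m pos by (simp add: r_def)
  have "\<forall>\<^sub>F n in sequentially. norm (p2 n - p1 n) < r" "\<forall>\<^sub>F n in sequentially. norm (q2 n - q1 n) < r"
    using order_tendstoD(2)[OF tendsto_norm_zero[OF p] r] order_tendstoD(2)[OF tendsto_norm_zero[OF q] r] by auto
  with lower show ?thesis
  proof eventually_elim
    case (elim n)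
    show ?case
    proof (intro allI impI, elim conjE)
      fix y assume y: "sphere_quot (p1 n) (q1 n) = Some y" "norm y \<le> M"
      then have q1: "q1 n \<noteq> 0" and p1: "p1 n = y * q1 n" by (auto simp: sphere_quot_def split: if_splits)
      have "norm (p1 n) \<le> M * norm (q1 n)" using y(2) by (simp add: p1 norm_mult mult_right_mono)
      then have "\<eta> \<le> (1 + M) * norm (q1 n)" using elim(1) by (simp add: algebra_simps)
      then have "m \<le> norm (q1 n)" using pos by (simp add: m_def pos_divide_le_eq mult.commute)
      moreover have "norm (q2 n - q1 n) < m / 2" using elim(3) by (simp add: r_def)
      moreover have "norm (q1 n) \<le> norm (q2 n) + norm (q2 n - q1 n)"
        by (metis norm_minus_commute norm_triangle_sub)
      ultimately have q2: "m / 2 < norm (q2 n)" by linarith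
      then have "q2 n \<noteq> 0" using m by auto
      have "p2 n / q2 n - y = ((p2 n - p1 n) - y * (q2 n - q1 n)) / q2 n"
        using \<open>q2 n \<noteq> 0\<close> by (simp add: p1 field_simps)
      then have "norm (p2 n / q2 n - y) = norm ((p2 n - p1 n) - y * (q2 n - q1 n)) / norm (q2 n)"
        by (simp add: norm_divide)
      also have "\<dots> \<le> (r + M * r) / (m / 2)"
      proof (rule frac_le)
        show "norm ((p2 n - p1 n) - y * (q2 n - q1 n)) \<le> r + M * r"
          by (rule order_trans[OF norm_triangle_ineq4])
             (use elim(2,3) y(2) pos r in \<open>auto simp: norm_mult intro!: add_mono mult_mono\<close>)
      qed (use q2 m r pos in auto)
      also have "\<dots> = (1 + M) * r / (m / 2)" by (simp add: algebra_simps)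
      also have "\<dots> \<le> (1 + M) * (e * (m / 2) / (2 * (1 + M))) / (m / 2)"
        using m pos by (intro divide_right_mono mult_left_mono) (auto simp: r_def)
      also have "\<dots> = e / 2" using m pos by (simp add: divide_simps)
      also have "\<dots> < e" using pos by simp
      finally show "\<exists>x. sphere_quot (p2 n) (q2 n) = Some x \<and> norm (x - y) < e"
        using \<open>q2 n \<noteq> 0\<close> by (simp add: sphere_quot_def)
    qed
  qed
qed

text \<open>The linear system with matrix \<open>(a, b; c, d)\<close> recovers the constant determinant from the two
  forms, so these cannot be small together.\<close>

lemma homogeneous_lower_bound:
  fixes a b c d :: complex
  assumes "a * d - b * c \<noteq> 0"
  obtains \<eta> where "\<eta> > 0" "\<And>w. \<eta> \<le> norm (a * w + b) + norm (c * w + d)"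
proof
  have pos: "norm a + norm c > 0" using assms by (cases "a = 0") (auto simp: add_pos_nonneg)
  show "norm (a * d - b * c) / (norm a + norm c) > 0" using assms pos by simp
  fix w
  have "norm (a * d - b * c) = norm (a * (c * w + d) - c * (a * w + b))" by (simp add: algebra_simps)
  also have "\<dots> \<le> norm a * norm (c * w + d) + norm c * norm (a * w + b)"
    by (rule order_trans[OF norm_triangle_ineq4]) (simp add: norm_mult)
  also have "\<dots> \<le> (norm a + norm c) * norm (c * w + d) + (norm a + norm c) * norm (a * w + b)"
    by (intro add_mono mult_right_mono) auto
  finally show "norm (a * d - b * c) / (norm a + norm c) \<le> norm (a * w + b) + norm (c * w + d)"
    using pos by (simp add: pos_divide_le_eq algebra_simps)
qed

text \<open>Closeness is needed in both directions: a value of \<open>g\<close> well inside the interval forces one of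
  \<open>f\<close> into it, and a value of \<open>f\<close> in the interval keeps \<open>g\<close> near it. On bounded sets the
  homogeneous asymptotics yields either.\<close>

lemma in_interval_perturbation:
  fixes a b c d :: complex
  assumes p: "(\<lambda>n. p n - (a * w n + b)) \<longlonglongrightarrow> 0" and q: "(\<lambda>n. q n - (c * w n + d)) \<longlonglongrightarrow> 0"
    and det: "a * d - b * c \<noteq> 0"
  defines "f \<equiv> \<lambda>n. sphere_quot (p n) (q n)" and "g \<equiv> \<lambda>n. sphere_moebius a b c d (Some (w n))"
  assumes real: "\<And>n. g n \<in> sphere_reals" and uv: "u \<le> v" and e: "e > 0"
  shows "\<forall>\<^sub>F i in sequentially.
      (in_interval (u + e) (v - e) (g i) \<longrightarrow> in_interval u v (if f i \<in> sphere_reals then f i else g i)) \<and>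
      (in_interval u v (if f i \<in> sphere_reals then f i else g i) \<longrightarrow> in_interval (u - e) (v + e) (g i))"
proof -
  obtain \<eta> where \<eta>: "\<eta> > 0" "\<And>w. \<eta> \<le> norm (a * w + b) + norm (c * w + d)"
    using homogeneous_lower_bound[OF det] by blast
  \<comment> \<open>A bound for all points of the enlarged interval.\<close>
  define M where "M = max \<bar>u\<bar> \<bar>v\<bar> + e"
  have M: "M \<ge> 0" using e by (simp add: M_def)
  have g: "g n = sphere_quot (a * w n + b) (c * w n + d)" for n by (simp add: g_def)
  have gf: "\<forall>\<^sub>F n in sequentially. \<forall>y. g n = Some y \<and> norm y \<le> M \<longrightarrow>
      (\<exists>x. f n = Some x \<and> norm (x - y) < e)"
    unfolding g f_def by (rule sphere_quot_close[OF p q _ \<eta>(1) e M]) (simp add: \<eta>(2))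
  have fg: "\<forall>\<^sub>F n in sequentially. \<forall>y. f n = Some y \<and> norm y \<le> M \<longrightarrow>
      (\<exists>x. g n = Some x \<and> norm (x - y) < e)"
    unfolding g f_def
  proof (rule sphere_quot_close[where \<eta> = "\<eta> / 2"])
    show "(\<lambda>n. a * w n + b - p n) \<longlonglongrightarrow> 0" "(\<lambda>n. c * w n + d - q n) \<longlonglongrightarrow> 0"
      using tendsto_minus[OF p] tendsto_minus[OF q] by simp_all
    have "\<eta> / 4 > 0" using \<eta>(1) by simp
    from order_tendstoD(2)[OF tendsto_norm_zero[OF p] this] order_tendstoD(2)[OF tendsto_norm_zero[OF q] this]
    show "\<forall>\<^sub>F n in sequentially. \<eta> / 2 \<le> norm (p n) + norm (q n)"
    proof eventually_elim
      case (elim n)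
      have "norm (a * w n + b) \<le> norm (p n) + norm (p n - (a * w n + b))"
        "norm (c * w n + d) \<le> norm (q n) + norm (q n - (c * w n + d))"
        by (metis norm_minus_commute norm_triangle_sub)+
      then show ?case using elim \<eta>(2)[of "w n"] by linarith
    qed
  qed (use \<eta> e M in auto)
  from gf fg show ?thesis
  proof eventually_elim
    case (elim n)
    have bound: "\<bar>y\<bar> \<le> M" if "u - e \<le> y" "y \<le> v + e" for y
      using that uv by (auto simp: M_def abs_le_iff)
    have 1: "in_interval u v (if f n \<in> sphere_reals then f n else g n)" if "in_interval (u + e) (v - e) (g n)"
    proof -
      from that obtain y :: real where y: "g n = Some (of_real y)" "u + e \<le> y" "y \<le> v - e"
        by (auto simp: in_interval_def)
      obtain x where x: "f n = Some x" "norm (x - of_real y) < e"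
        using elim(1) y bound[of y] e by auto
      show ?thesis
      proof (cases "f n \<in> sphere_reals")
        case True
        then obtain x' where "x = of_real x'" using x(1) by (auto simp: sphere_reals_def elim: Reals_cases)
        then have "\<bar>x' - y\<bar> < e" using x(2) by (simp flip: of_real_diff)
        then have "x' \<in> {u..v}" using y by auto
        then show ?thesis using True x \<open>x = of_real x'\<close> by (auto simp: in_interval_def)
      next
        case False
        have "y \<in> {u..v}" using y e by auto
        then show ?thesis using False y(1) by (auto simp: in_interval_def)
      qed
    qed
    have 2: "in_interval (u - e) (v + e) (g n)" if "in_interval u v (if f n \<in> sphere_reals then f n else g n)"
    proof (cases "f n \<in> sphere_reals")
      case True
      with that obtain y :: real where y: "f n = Some (of_real y)" "u \<le> y" "y \<le> v"
        by (auto simp: in_interval_def)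
      obtain x where x: "g n = Some x" "norm (x - of_real y) < e"
        using elim(2) y bound[of y] e by auto
      obtain x' where "x = of_real x'" using real[of n] x(1) by (auto simp: sphere_reals_def elim: Reals_cases)
      then have "\<bar>x' - y\<bar> < e" using x(2) by (simp flip: of_real_diff)
      then have "x' \<in> {u - e..v + e}" using y by auto
      then show ?thesis using x \<open>x = of_real x'\<close> by (auto simp: in_interval_def)
    next
      case False
      with that obtain y :: real where "g n = Some (of_real y)" "u \<le> y" "y \<le> v"
        by (auto simp: in_interval_def)
      moreover from this have "y \<in> {u - e..v + e}" using e by auto
      ultimately show ?thesis by (auto simp: in_interval_def)
    qed
    show ?case using 1 2 by blast
  qed
qed


section \<open>Approximants whose sequential closure is a line\<close>

lemma finite_powers_of_root_of_unity:
  fixes \<zeta> :: complex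
  assumes "\<zeta> ^ k = 1" "k > 0"
  shows "finite (range (\<lambda>n. \<zeta> ^ n))"
proof -
  have "\<zeta> ^ n = \<zeta> ^ (n mod k)" for n
  proof -
    have "\<zeta> ^ n = \<zeta> ^ (k * (n div k) + n mod k)" by simp
    also have "\<dots> = \<zeta> ^ (n mod k)" unfolding power_add power_mult assms(1) by simp
    finally show ?thesis .
  qed
  then have "range (\<lambda>n. \<zeta> ^ n) \<subseteq> (\<lambda>n. \<zeta> ^ n) ` {..<k}"
    using assms(2) by (metis image_iff image_subsetI lessThan_iff mod_less_divisor)
  then show ?thesis using finite_subset by blast
qed

text \<open>For a root of unity \<open>\<zeta>\<close> the asymptotic sequence is periodic, which leaves finitely many
  limits.\<close>

lemma irrational_angle_if_infinite_closure:
  assumes p: "(\<lambda>n. p n - (a * \<zeta> ^ Suc n + b)) \<longlonglongrightarrow> 0" and q: "(\<lambda>n. q n - (c * \<zeta> ^ Suc n + d)) \<longlonglongrightarrow> 0"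
    and \<zeta>: "norm \<zeta> = 1" and det: "a * d - b * c \<noteq> 0"
    and inf: "infinite (sequential_closure (\<lambda>n. sphere_quot (p n) (q n)))"
  shows "Arg \<zeta> / (2 * pi) \<notin> \<rat>"
proof
  assume "Arg \<zeta> / (2 * pi) \<in> \<rat>"
  then obtain m k :: int where "k > 0" "Arg \<zeta> / (2 * pi) = real_of_int m / real_of_int k"
    by (auto elim!: Rats_cases')
  moreover define n where "n = nat k"
  ultimately have "n \<noteq> 0" "Arg \<zeta> / (2 * pi) = real_of_int m / real n" by auto
  then have "real n * Arg \<zeta> = 2 * pi * real_of_int m" by (simp add: field_simps)
  moreover have "\<zeta> = cis (Arg \<zeta>)" using \<zeta> rcis_cmod_Arg[of \<zeta>] by (simp add: rcis_def)
  ultimately have "\<zeta> ^ n = cis (2 * pi * real_of_int m)" by (metis Complex.DeMoivre)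
  then have "\<zeta> ^ n = 1" by (simp add: cis_multiple_2pi)
  from finite_powers_of_root_of_unity[OF this] \<open>n \<noteq> 0\<close>
  have fin: "finite (range (\<lambda>n. \<zeta> ^ n))" by simp
  have "sequential_closure (\<lambda>n. sphere_quot (p n) (q n)) \<subseteq> sphere_moebius a b c d ` Some ` range (\<lambda>n. \<zeta> ^ n)"
    by (rule sequential_closure_subset_image[OF p q finite_imp_compact[OF fin] rangeI det])
  then show False using inf fin by (meson finite_imageI finite_subset)
qed

lemma moebius_line_parameters:
  assumes det: "a * d - b * c \<noteq> 0" and v: "norm v = 1"
    and sub: "sphere_line z v \<subseteq> sphere_moebius a b c d ` Some ` sphere 0 1"
  obtains t0 \<kappa> :: real where "c \<noteq> 0" "d \<noteq> 0" "norm (d / c) = 1" "(a / c + b / d) / 2 = z + of_real t0 * v"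
    "- ((a / c - b / d) / (2 * \<i>)) = of_real \<kappa> * v" "\<kappa> \<noteq> 0"
proof -
  have "None \<in> sphere_line z v" by (simp add: sphere_line_def)
  with sub have "None \<in> sphere_moebius a b c d ` Some ` sphere 0 1" by blast
  note cd = moebius_circle_line_coefficients[OF det this]
  have "d / c = cis (Arg (d / c))" using cd(3) rcis_cmod_Arg[of "d / c"] by (simp add: rcis_def)
  moreover have "v \<noteq> 0" using v by auto
  ultimately show thesis using line_within_moebius_circle[OF _ cd(1) _ sub] cd that by blast
qed

text \<open>
  Since the line is real, the centre and the scale in the tangent formula are real numbers. The
  frequencies of \<open>g\<close> are those of an irrational rotation seen through the tangent, and they pass to
  the approximants by asymptotic equality.
\<close>

lemma limiting_pdf_of_real_closure:
  assumes p: "(\<lambda>n. p n - (a * \<zeta> ^ Suc n + b)) \<longlonglongrightarrow> 0" and q: "(\<lambda>n. q n - (c * \<zeta> ^ Suc n + d)) \<longlonglongrightarrow> 0"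
    and \<zeta>: "norm \<zeta> = 1" and det: "a * d - b * c \<noteq> 0"
  defines "f \<equiv> \<lambda>n. sphere_quot (p n) (q n)" and "h \<equiv> sphere_moebius a b c d"
  assumes closure: "sequential_closure f = sphere_reals"
  shows "\<exists>x0 \<delta> :: real. of_real x0 = (a / c + b / d) / 2 \<and> of_real \<delta> = (a / c - b / d) / (2 * \<i>) \<and> \<delta> \<noteq> 0 \<and>
    is_limiting_pdf f (\<lambda>n. h (Some (\<zeta> ^ (n + 1)))) h (cauchy_density x0 \<bar>\<delta>\<bar>)"
proof -
  have line: "sphere_reals = sphere_line 0 1" by (simp add: sphere_reals_def sphere_line_def Reals_def)
  have "sequential_closure f \<subseteq> h ` Some ` sphere 0 1"
    unfolding f_def h_def
    by (rule sequential_closure_subset_image[OF p q compact_sphere _ det])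
       (use \<zeta> in \<open>simp add: norm_mult norm_power\<close>)
  then have "sphere_line 0 1 \<subseteq> h ` Some ` sphere 0 1" by (simp add: closure line)
  then obtain t0 \<kappa> :: real where c: "c \<noteq> 0" "norm (d / c) = 1"
    and x0: "(a / c + b / d) / 2 = 0 + of_real t0 * 1"
    and \<kappa>: "- ((a / c - b / d) / (2 * \<i>)) = of_real \<kappa> * 1" "\<kappa> \<noteq> 0"
    using moebius_line_parameters[OF det norm_one] unfolding h_def by metis
  have \<delta>: "of_real (- \<kappa>) = (a / c - b / d) / (2 * \<i>)" using \<kappa>(1) by (metis minus_minus mult.right_neutral of_real_minus)
  define F where "F = cauchy_cdf t0 (\<bar>\<kappa>\<bar>)"
  define g where "g n = h (Some (\<zeta> ^ (n + 1)))" for n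
  define \<nu> where "\<nu> = Arg \<zeta>"
  define \<theta>1 where "\<theta>1 = Arg (d / c)"
  have \<theta>1: "d / c = cis \<theta>1" using c(2) rcis_cmod_Arg[of "d / c"] by (simp add: rcis_def \<theta>1_def)
  have "infinite (sequential_closure f)" unfolding closure line by (rule infinite_sphere_line) simp
  then have irr: "\<nu> / (2 * pi) \<notin> \<rat>"
    unfolding \<nu>_def f_def by (intro irrational_angle_if_infinite_closure[OF p q \<zeta> det])
  have g: "g i = (if cos ((real (i + 1) * \<nu> - \<theta>1) / 2) = 0 then None
     else Some (of_real (t0 + \<kappa> * tan ((real (i + 1) * \<nu> - \<theta>1) / 2))))" for i
  proof -
    have "\<zeta> = cis \<nu>" using \<zeta> rcis_cmod_Arg[of \<zeta>] by (simp add: rcis_def \<nu>_def)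
    then have "\<zeta> ^ (i + 1) = cis (real (i + 1) * \<nu>)" by (simp only: Complex.DeMoivre)
    then show ?thesis
      unfolding g_def h_def using moebius_circle_tan[OF c(1) \<theta>1, of a b "real (i + 1) * \<nu>"] x0 \<delta>[symmetric]
      by simp
  qed
  have freq: "(\<lambda>n. real (hits (\<lambda>i. in_interval u v (g i)) n) / real n) \<longlonglongrightarrow> F v - F u" if "u \<le> v" for u v
    unfolding F_def by (rule cauchy_frequencies[OF irr \<kappa>(2) that]) (rule g)
  have "is_concentration h 0 1 (\<lambda>y. case y of None \<Rightarrow> 0 | Some w \<Rightarrow> cauchy_density t0 \<bar>\<kappa>\<bar> (Re w))"
    unfolding h_def by (rule moebius_line_concentration[OF norm_one c x0 \<kappa>]) (auto intro!: measurable_from_sphere)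
  moreover have "has_limiting_frequencies g (cauchy_density t0 \<bar>\<kappa>\<bar>)"
    by (rule has_limiting_frequencies_cauchyI) (use \<kappa>(2) freq in \<open>auto simp: F_def\<close>)
  moreover have "has_limiting_frequencies (\<lambda>i. if f i \<in> sphere_reals then f i else g i) (cauchy_density t0 \<bar>\<kappa>\<bar>)"
  proof (rule has_limiting_frequencies_cauchyI)
    show "\<bar>\<kappa>\<bar> > 0" using \<kappa>(2) by simp
    fix u v :: real assume "u \<le> v"
    have cont: "isCont F x" for x
      unfolding F_def using DERIV_cauchy_cdf[of "\<bar>\<kappa>\<bar>"] \<kappa>(2) by (intro DERIV_isCont) auto
    have mono: "F x \<le> F y" if "x \<le> y" for x y
      unfolding F_def using \<kappa>(2) that by (intro cauchy_cdf_mono) auto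
    have real: "g n \<in> sphere_reals" for n unfolding g by (auto simp: sphere_reals_def)
    show "(\<lambda>n. real (hits (\<lambda>i. in_interval u v (if f i \<in> sphere_reals then f i else g i)) n) / real n)
        \<longlonglongrightarrow> cauchy_cdf t0 (\<bar>\<kappa>\<bar>) v - cauchy_cdf t0 (\<bar>\<kappa>\<bar>) u"
      unfolding F_def[symmetric]
    proof (rule frequencies_perturbation[where F = F and g = g])
      fix u v e :: real assume "u \<le> v" "e > 0"
      show "\<forall>\<^sub>F i in sequentially.
        (in_interval (u + e) (v - e) (g i) \<longrightarrow> in_interval u v (if f i \<in> sphere_reals then f i else g i)) \<and>
        (in_interval u v (if f i \<in> sphere_reals then f i else g i) \<longrightarrow> in_interval (u - e) (v + e) (g i))"
        unfolding f_def g_def h_def Suc_eq_plus1[symmetric]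
        by (rule in_interval_perturbation[OF p q det])
           (use real \<open>u \<le> v\<close> \<open>e > 0\<close> in \<open>simp_all only: g_def h_def Suc_eq_plus1\<close>)
    qed (fact mono cont freq \<open>u \<le> v\<close>)+
  qed
  ultimately have "is_limiting_pdf f g h (cauchy_density t0 \<bar>- \<kappa>\<bar>)"
    by (simp add: is_limiting_pdf_def)
  then show ?thesis
    using x0 \<delta> \<kappa>(2) unfolding g_def by (intro exI[of _ t0] exI[of _ "- \<kappa>"]) simp
qed

theorem corollary6:
  fixes p q A B P Q :: "nat \<Rightarrow> complex" and \<alpha> \<beta> a b c d :: complex
    and f :: "nat \<Rightarrow> complex option" and h :: "complex option \<Rightarrow> complex option"
  assumes "summable (\<lambda>n. norm (p (Suc n)) + norm (q (Suc n)))"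
    and "\<alpha> \<noteq> \<beta>" and "norm \<alpha> = norm \<beta>" and "norm \<alpha> \<noteq> 0"
    and "A = (\<lambda>n. - (\<alpha> * \<beta>) + q n)" and "B = (\<lambda>n. \<alpha> + \<beta> + p n)"
    and "\<And>i j. i \<ge> 1 \<Longrightarrow> j \<ge> 1 \<Longrightarrow> A i = 0 \<Longrightarrow> A j = 0 \<Longrightarrow> i = j"
    and "\<And>n. n \<ge> 1 \<Longrightarrow> \<not> (A n = 0 \<and> B n = 0)"
    and "P = (\<lambda>n. cf_num A B (Suc n))" and "Q = (\<lambda>n. cf_den A B (Suc n))"
    and "f = approximant A B"
    and "a = lim (\<lambda>n. (P n - \<beta> * P (n - 1)) / \<alpha> ^ n)"
    and "b = - lim (\<lambda>n. (P n - \<alpha> * P (n - 1)) / \<beta> ^ n)"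
    and "c = lim (\<lambda>n. (Q n - \<beta> * Q (n - 1)) / \<alpha> ^ n)"
    and "d = - lim (\<lambda>n. (Q n - \<alpha> * Q (n - 1)) / \<beta> ^ n)"
    and "h = sphere_moebius a b c d"
  shows "(\<forall>z v. norm v = 1 \<and> sequential_closure f = sphere_line z v \<longrightarrow>
            h None = Some (a / c) \<and> h (Some 0) = Some (b / d) \<and>
            is_highest_concentration h z v (Some ((a / c + b / d) / 2)))
       \<and> (sequential_closure f = sphere_reals \<longrightarrow>
            (\<exists>x0 \<delta> :: real.
               of_real x0 = (a / c + b / d) / 2 \<and>
               of_real \<delta> = (a / c - b / d) / (2 * \<i>) \<and> \<delta> \<noteq> 0 \<and>
               is_limiting_pdf f (\<lambda>n. h (Some ((\<alpha> / \<beta>) ^ (n + 1)))) h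
                 (cauchy_density x0 \<bar>\<delta>\<bar>)))"
proof -
  interpret num: perturbed_recurrence p q A B "cf_num A B" \<alpha> \<beta>
    by unfold_locales (use assms in auto)
  interpret den: perturbed_recurrence p q A B "cf_den A B" \<alpha> \<beta>
    by unfold_locales (use assms in auto)
  have lims: "a = lim num.U" "b = - lim num.W" "c = lim den.U" "d = - lim den.W"
    unfolding assms(9,10,12-15)
    using num.tendsto_shift den.tendsto_shift by (simp_all add: limI)
  define \<zeta> where "\<zeta> = \<alpha> / \<beta>"
  have \<zeta>: "norm \<zeta> = 1" using num.nonzero by (simp add: \<zeta>_def norm_divide num.norm_eq)
  \<comment> \<open>Rescaling numerator and denominator by a common factor does not change the approximant.\<close>
  define \<sigma> where "\<sigma> n = (\<alpha> - \<beta>) / \<beta> ^ Suc n" for n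
  define p' where "p' n = \<sigma> n * cf_num A B (Suc n)" for n
  define q' where "q' n = \<sigma> n * cf_den A B (Suc n)" for n
  have p': "(\<lambda>n. p' n - (a * \<zeta> ^ Suc n + b)) \<longlonglongrightarrow> 0"
    using num.normalized_asymptotic by (simp add: p'_def \<sigma>_def \<zeta>_def lims)
  have q': "(\<lambda>n. q' n - (c * \<zeta> ^ Suc n + d)) \<longlonglongrightarrow> 0"
    using den.normalized_asymptotic by (simp add: q'_def \<sigma>_def \<zeta>_def lims)
  have "sphere_quot (\<sigma> n * x) (\<sigma> n * y) = sphere_quot x y" for n x y
    using num.ne num.nonzero by (simp add: \<sigma>_def sphere_quot_def)
  then have f: "f = (\<lambda>n. sphere_quot (p' n) (q' n))"
    by (simp add: assms(11) approximant_def[abs_def] p'_def q'_def)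
  have det: "a * d - b * c \<noteq> 0" if inf: "infinite (sequential_closure f)"
  proof (rule limit_determinant_nonzero[OF num.perturbed_recurrence_axioms den.perturbed_recurrence_axioms _ lims])
    fix N
    show "A (Suc N) \<noteq> 0"
    proof
      assume zero: "A (Suc N) = 0"
      have "\<forall>\<^sub>F n in sequentially. f n \<in> {None, approximant A B N}"
        using eventually_ge_at_top[of N] unfolding assms(11)
        by (rule eventually_mono) (rule two_values_after_zero[where A = A and N = N, OF zero])
      then have "sequential_closure f \<subseteq> {None, approximant A B N}"
        by (intro sequential_closure_subset_finite) auto
      then show False using inf finite_subset by auto
    qed
  qed
  show ?thesis
  proof (intro conjI allI impI)
    fix z v assume "norm v = 1 \<and> sequential_closure f = sphere_line z v"
    then have v: "norm v = 1" and closure: "sequential_closure f = sphere_line z v" by auto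
    have "infinite (sequential_closure f)"
      unfolding closure by (rule infinite_sphere_line) (use v in auto)
    note det = det[OF this]
    have "sphere_line z v \<subseteq> sphere_moebius a b c d ` Some ` sphere 0 1"
      unfolding closure[symmetric] f
      by (rule sequential_closure_subset_image[OF p' q' compact_sphere _ det])
         (use \<zeta> in \<open>simp add: norm_mult norm_power\<close>)
    then obtain t0 \<kappa> :: real where cd: "c \<noteq> 0" "d \<noteq> 0" "norm (d / c) = 1"
      and x0: "(a / c + b / d) / 2 = z + of_real t0 * v"
      and \<kappa>: "- ((a / c - b / d) / (2 * \<i>)) = of_real \<kappa> * v" "\<kappa> \<noteq> 0"
      by (rule moebius_line_parameters[OF det v])
    show "h None = Some (a / c)" "h (Some 0) = Some (b / d)"
      using cd by (simp_all add: assms(16) sphere_quot_def)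
    show "is_highest_concentration h z v (Some ((a / c + b / d) / 2))"
      unfolding assms(16) by (rule moebius_line_highest_concentration[OF v cd(1,3) x0 \<kappa>])
  next
    assume closure: "sequential_closure f = sphere_reals"
    have "sphere_reals = sphere_line 0 1" by (simp add: sphere_reals_def sphere_line_def Reals_def)
    then have "infinite (sequential_closure f)" using closure infinite_sphere_line[of 1 0] by simp
    from limiting_pdf_of_real_closure[OF p' q' \<zeta> det[OF this], folded f, OF closure]
    show "\<exists>x0 \<delta> :: real. of_real x0 = (a / c + b / d) / 2 \<and> of_real \<delta> = (a / c - b / d) / (2 * \<i>) \<and> \<delta> \<noteq> 0 \<and>
      is_limiting_pdf f (\<lambda>n. h (Some ((\<alpha> / \<beta>) ^ (n + 1)))) h (cauchy_density x0 \<bar>\<delta>\<bar>)"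
      unfolding assms(16) \<zeta>_def .
  qed
qed

end
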